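(* Let $n \geq 1$ and let $G$ be a multigraph with vertex set $V(G) = \{0,1,\ldots,n\}$ and root $0$. If $\mathrm{PF}(G)$ is invariant under the action of the symmetric group $\mathfrak{S}_n$ on $\mathbb{N}^n$, then one of the following holds: \begin{itemize} \item $G$ is an $a$-tree and $\mathrm{PF}(G) = \mathrm{PF}\big( (a,\overbrace{0,0,\ldots,0}^{n-1}) \big)$ for some $a\geq 1$; \item $G$ is an $a$-cycle and $\mathrm{PF}(G) = \mathrm{PF}\big( (a,\overbrace{0,0,\ldots,0}^{n-2},a) \big)$ for some $a\geq 1$; \item $G = K_{n+1}^{a,b}$ and $\mathrm{PF}(G) = \mathrm{PF}\big( (a,\overbrace{b,b,\ldots,b}^{n-1}) \big)$ for some $a,b\geq 1$. \end{itemize} On the other hand, if $\mathrm{PF}(G)$ is not invariant under the action of the symmetric group $\mathfrak{S}_n$, then $\mathrm{PF}(G) \neq \mathrm{PF}(\mathbf{x})$ for any $\mathbf{x} \in \mathbb{N}^{n}$.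
   Context: $\mathbb{N} = \{0,1,2,\ldots\}$. The group $\mathfrak{S}_n$ acts on $\mathbb{N}^n$ by $\sigma(\alpha) := (\alpha_{\sigma^{-1}(1)},\ldots,\alpha_{\sigma^{-1}(n)})$ for $\sigma \in \mathfrak{S}_n$ and $\alpha = (\alpha_1,\ldots,\alpha_n) \in \mathbb{N}^n$. A multigraph $G$ is a finite undirected graph in which multiple edges, but not loops, are allowed; it consists of a vertex set $V(G)$ together with an edge-weight (multiplicity) function $\omega_G \colon \binom{V(G)}{2} \to \mathbb{N}$, and it comes with a distinguished root vertex. Write $\#E(G) := \sum_{e \in \binom{V(G)}{2}} \omega_G(e)$ for the number of edges counted with multiplicity, and $\deg_G(i) := \sum_{j \in V(G),\, j \neq i} \omega_G(\{i,j\})$. For a set $U$ of non-root vertices and $i \in U$, put $\deg^G_U(i) := \sum_{j \in V(G)-U} \omega_G(\{i,j\})$. A multigraph $G$ is connected if for each nonempty set $U$ of non-root vertices there is $i \in U$ with $\deg^G_U(i) \geq 1$. Graphical parking functions: for $G$ a multigraph with $V(G) = \{0,1,\ldots,n\}$ and root $0$, a $G$-parking function is a sequence $(\alpha_1,\ldots,\alpha_n) \in \mathbb{N}^n$ such that for every nonempty $U \subseteq \{1,\ldots,n\}$ there is $i \in U$ with $\alpha_i \leq \deg^G_U(i) - 1$. The set of $G$-parking functions is denoted $\mathrm{PF}(G)$. Vector parking functions: for $\mathbf{x} = (x_1,\ldots,x_n) \in \mathbb{N}^n$, $\mathrm{PF}(\mathbf{x})$ is the set of sequences $(\alpha_1,\ldots,\alpha_n)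 \in \mathbb{N}^n$ whose weakly increasing rearrangement $\alpha_{i_1} \leq \cdots \leq \alpha_{i_n}$ satisfies $\alpha_{i_j} \leq \left(\sum_{k=1}^{j} x_k\right) - 1$ for all $1 \leq j \leq n$. Families of multigraphs: a tree is a connected multigraph $T$ with $\#E(T) = \#V(T)-1$; a cycle is a connected multigraph $C$ with $\deg_C(i) = 2$ for all $i \in V(C)$. For $a \geq 1$, $G$ is an $a$-tree (respectively an $a$-cycle) if there is a tree (respectively a cycle) $H$ with $V(H) = V(G)$ and $\omega_G(e) = a \cdot \omega_H(e)$ for all $e \in \binom{V(G)}{2}$. For $a,b \geq 1$, $K_{n+1}^{a,b}$ is the multigraph with vertex set $\{0,1,\ldots,n\}$ and edge-weight function given by $\omega(\{i,j\}) = a$ if $i=0$ or $j=0$, and $\omega(\{i,j\}) = b$ otherwise.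
   Formalization: In the first part G is additionally assumed connected; for disconnected G (e.g. n=1 with no edges) PF(G) is empty, hence invariant, but G is neither an a-tree, an a-cycle nor K_{n+1}^{a,b} with a,b ≥ 1. *)

theory Defs
  imports "HOL-Library.FuncSet" "HOL-Library.Ramsey" "HOL-Combinatorics.Permutations"
begin

section \<open>Multigraphs\<close>

text \<open>The edge multiplicity is a function on the two-element subsets of the vertex set. It is
  totalised by the value 0 on all other sets (see \<open>multigraph\<close> below), so that two multigraphs are
  equal as records iff they have the same vertices, root and multiplicities.\<close>

record 'v multigraph =
  verts :: "'v set"
  root_vertex :: 'v
  edge_weight :: "'v set \<Rightarrow> nat"

definition multigraph :: "'v multigraph \<Rightarrow> bool" where
  "multigraph G \<longleftrightarrow> finite (verts G) \<and> root_vertex G \<in> verts G \<and>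
     (\<forall>e. e \<notin> nsets (verts G) 2 \<longrightarrow> edge_weight G e = 0)"

definition nonroots :: "'v multigraph \<Rightarrow> 'v set" where
  "nonroots G = verts G - {root_vertex G}"

definition num_edges :: "'v multigraph \<Rightarrow> nat" where
  "num_edges G = (\<Sum>e\<in>nsets (verts G) 2. edge_weight G e)"

definition degree :: "'v multigraph \<Rightarrow> 'v \<Rightarrow> nat" where
  "degree G i = (\<Sum>j\<in>verts G - {i}. edge_weight G {i, j})"

definition degree_out :: "'v multigraph \<Rightarrow> 'v set \<Rightarrow> 'v \<Rightarrow> nat" where
  "degree_out G U i = (\<Sum>j\<in>verts G - U. edge_weight G {i, j})"

definition connected_multigraph :: "'v multigraph \<Rightarrow> bool" where
  "connected_multigraph G \<longleftrightarrow>
     (\<forall>U. U \<subseteq> nonroots G \<and> U \<noteq> {} \<longrightarrow> (\<exists>i\<in>U. degree_out G U i \<ge> 1))"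

definition is_tree :: "'v multigraph \<Rightarrow> bool" where
  "is_tree T \<longleftrightarrow> multigraph T \<and> connected_multigraph T \<and> int (num_edges T) = int (card (verts T)) - 1"

definition is_cycle :: "'v multigraph \<Rightarrow> bool" where
  "is_cycle C \<longleftrightarrow> multigraph C \<and> connected_multigraph C \<and> (\<forall>i\<in>verts C. degree C i = 2)"

definition is_a_tree :: "nat \<Rightarrow> 'v multigraph \<Rightarrow> bool" where
  "is_a_tree a G \<longleftrightarrow> (\<exists>H. is_tree H \<and> verts H = verts G \<and>
     (\<forall>e\<in>nsets (verts G) 2. edge_weight G e = a * edge_weight H e))"

definition is_a_cycle :: "nat \<Rightarrow> 'v multigraph \<Rightarrow> bool" where
  "is_a_cycle a G \<longleftrightarrow> (\<exists>H. is_cycle H \<and> verts H = verts G \<and>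
     (\<forall>e\<in>nsets (verts G) 2. edge_weight G e = a * edge_weight H e))"

text \<open>\<open>complete_multigraph n a b\<close> is $K_{n+1}^{a,b}$.\<close>

definition complete_multigraph :: "nat \<Rightarrow> nat \<Rightarrow> nat \<Rightarrow> nat multigraph" where
  "complete_multigraph n a b =
     \<lparr>verts = {0..n}, root_vertex = 0,
      edge_weight = (\<lambda>e. if e \<in> nsets {0..n} 2 then (if 0 \<in> e then a else b) else 0)\<rparr>"

section \<open>Parking functions\<close>

text \<open>A sequence in $\mathbb{N}^n$ is an extensional function on \<open>{1..n}\<close>. Bounds of the form
  ``$\ldots - 1$'' are stated over the integers, since subtraction on \<open>nat\<close> truncates.\<close>

definition nat_vectors :: "nat \<Rightarrow> (nat \<Rightarrow> nat) set" where
  "nat_vectors n = {1..n} \<rightarrow>\<^sub>E (UNIV :: nat set)"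

definition graph_PF :: "'v multigraph \<Rightarrow> ('v \<Rightarrow> nat) set" where
  "graph_PF G = {\<alpha> \<in> nonroots G \<rightarrow>\<^sub>E (UNIV :: nat set).
     \<forall>U. U \<subseteq> nonroots G \<and> U \<noteq> {} \<longrightarrow> (\<exists>i\<in>U. int (\<alpha> i) \<le> int (degree_out G U i) - 1)}"

text \<open>The \<open>j\<close>-th smallest entry (counted from 1) of \<open>\<alpha>\<close>.\<close>

definition order_stat :: "nat \<Rightarrow> (nat \<Rightarrow> nat) \<Rightarrow> nat \<Rightarrow> nat" where
  "order_stat n \<alpha> j = sort (map \<alpha> [1..<Suc n]) ! (j - 1)"

definition vector_PF :: "nat \<Rightarrow> (nat \<Rightarrow> nat) \<Rightarrow> (nat \<Rightarrow> nat) set" where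
  "vector_PF n x = {\<alpha> \<in> nat_vectors n.
     \<forall>j\<in>{1..n}. int (order_stat n \<alpha> j) \<le> int (\<Sum>k=1..j. x k) - 1}"

definition perm_act :: "(nat \<Rightarrow> nat) \<Rightarrow> (nat \<Rightarrow> nat) \<Rightarrow> (nat \<Rightarrow> nat)" where
  "perm_act \<sigma> \<alpha> = (\<lambda>i. \<alpha> (inv \<sigma> i))"

definition symmetric_invariant :: "nat \<Rightarrow> (nat \<Rightarrow> nat) set \<Rightarrow> bool" where
  "symmetric_invariant n S \<longleftrightarrow> (\<forall>\<sigma>. \<sigma> permutes {1..n} \<longrightarrow> (\<forall>\<alpha>\<in>S. perm_act \<sigma> \<alpha> \<in> S))"

end

theory Submission
  imports Defs
begin

text \<open>Membership in a set of vector parking functions depends only on the numbers of entries below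
  certain thresholds, so such a set is always invariant under permutations. This settles the case
  in which the set of \<open>G\<close>-parking functions is not invariant.

  Conversely, let \<open>G\<close> be connected with an invariant set of parking functions. For a set \<open>T\<close> of
  non-root vertices, let \<open>R(T)\<close> be the component of the root in \<open>G - T\<close>. A vector that vanishes off
  \<open>S\<close> is parking iff every nonempty \<open>T \<subseteq> S\<close> contains a vertex \<open>i\<close> whose entry is smaller than the number
  of edges between \<open>i\<close> and \<open>R(T)\<close> (\<open>parking_reachD\<close> and \<open>parking_reachI\<close>). For singletons \<open>S\<close>,
  invariance makes the number of edges from \<open>i\<close> to \<open>R({i})\<close> a constant \<open>M\<close>. For pairs it yields two
  possibilities (\<open>invariant_cases\<close>).

  Tree type: for all \<open>p \<noteq> q\<close>, at least one of \<open>p\<close>, \<open>q\<close> has \<open>M\<close> or more edges to \<open>R({p, q})\<close>. Then of two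
  adjacent non-root vertices, one separates the other from the root. Hence every non-root vertex
  \<open>i\<close> has exactly one neighbour in \<open>R({i})\<close>, all \<open>M\<close> edges of \<open>i\<close> to \<open>R({i})\<close> go there, and \<open>G\<close> is an
  \<open>M\<close>-tree.

  Uniform type: there is \<open>A < M\<close> such that for all \<open>p \<noteq> q\<close>, the vertex \<open>p\<close> has exactly \<open>A\<close> edges to
  \<open>R({p, q})\<close>. Then every \<open>G - i\<close> is connected, every non-root vertex has degree \<open>M\<close>, and the parking
  functions of \<open>G - i\<close> are those of \<open>G\<close> whose entry at \<open>i\<close> is \<open>M - 1\<close>. So they are again invariant,
  and they are the same for all \<open>i\<close> up to relabelling. If every \<open>G - p - q\<close> is connected, then
  \<open>w(p, q) = M - A\<close> for all \<open>p \<noteq> q\<close> and \<open>G\<close> is a complete multigraph. Otherwise some \<open>G - p\<close>, and hence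
  every \<open>G - i\<close>, has tree type with constant \<open>A\<close>. So all multiplicities are \<open>0\<close> or \<open>A\<close>, and counting edges
  forces all degrees to be \<open>2 A\<close> (\<open>uniform_type_cycle\<close>); thus \<open>G\<close> is an \<open>A\<close>-cycle.\<close>

section \<open>Parking functions and reachability from the root\<close>

text \<open>A multigraph is represented here by its multiplicities alone, and the set \<open>N\<close> of non-root vertices
  is a parameter of every notion. Deleting vertices then means shrinking \<open>N\<close>, with the same weights.\<close>

locale rooted_weights =
  fixes w :: "'v \<Rightarrow> 'v \<Rightarrow> nat" and r :: 'v
  assumes sym: "w u v = w v u" and loopless: "w u u = 0"
begin

definition wt :: "'v set \<Rightarrow> 'v \<Rightarrow> nat" where
  "wt X i = (\<Sum>j\<in>X. w i j)"

definition parking :: "'v set \<Rightarrow> ('v \<Rightarrow> nat) \<Rightarrow> bool" where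
  "parking N \<alpha> \<longleftrightarrow> (\<forall>U\<subseteq>N. U \<noteq> {} \<longrightarrow> (\<exists>i\<in>U. \<alpha> i < wt (insert r (N - U)) i))"

inductive_set reach :: "'v set \<Rightarrow> 'v set" for N where
  root: "r \<in> reach N"
| step: "u \<in> reach N \<Longrightarrow> v \<in> N \<Longrightarrow> w v u > 0 \<Longrightarrow> v \<in> reach N"

lemma reach_subset: "reach N \<subseteq> insert r N"
proof
  fix v assume "v \<in> reach N" then show "v \<in> insert r N" by induction auto
qed

lemma finite_reach: "finite N \<Longrightarrow> finite (reach N)"
  using reach_subset[of N] by (simp add: finite_subset)

lemma reach_mono: "A \<subseteq> B \<Longrightarrow> reach A \<subseteq> reach B"
proof
  fix v assume "A \<subseteq> B" and v: "v \<in> reach A"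
  from v show "v \<in> reach B"
    by induction (use \<open>A \<subseteq> B\<close> in \<open>auto intro: reach.intros\<close>)
qed

lemma reach_full: "N \<subseteq> reach N \<Longrightarrow> reach N = insert r N"
  using reach_subset[of N] reach.root[of N] by auto

lemma wt_mono: "finite Y \<Longrightarrow> X \<subseteq> Y \<Longrightarrow> wt X i \<le> wt Y i"
  unfolding wt_def by (rule sum_mono2) auto

lemma wt_ge: "finite X \<Longrightarrow> j \<in> X \<Longrightarrow> w i j \<le> wt X i"
  unfolding wt_def by (rule member_le_sum) auto

lemma wt_insert: "finite X \<Longrightarrow> j \<notin> X \<Longrightarrow> wt (insert j X) i = w i j + wt X i"
  unfolding wt_def by simp

lemma wt_posE:
  assumes "wt X i > 0" obtains j where "j \<in> X" "w i j > 0"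
  using assms unfolding wt_def by (metis sum.neutral neq0_conv)

text \<open>On a path from the root to a vertex of \<open>U\<close>, the first vertex in \<open>U\<close> has its predecessor outside \<open>U\<close>.\<close>

lemma reach_first_hit:
  assumes "v \<in> reach A" "v \<in> U" "r \<notin> U"
  shows "\<exists>j\<in>U \<inter> reach A. \<exists>u\<in>reach A - U. w j u > 0"
  using assms
proof induction
  case (step u v)
  show ?case
  proof (cases "u \<in> U")
    case False
    then show ?thesis using step reach.step[OF step.hyps] by blast
  qed (use step in blast)
qed simp

lemma parking_antimono:
  assumes "parking N \<alpha>" "\<And>i. i \<in> N \<Longrightarrow> \<beta> i \<le> \<alpha> i"
  shows "parking N \<beta>"
  unfolding parking_def
proof (intro allI impI)
  fix U assume U: "U \<subseteq> N" "U \<noteq> {}"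
  then obtain i where "i \<in> U" "\<alpha> i < wt (insert r (N - U)) i"
    using assms(1) unfolding parking_def by blast
  then show "\<exists>i\<in>U. \<beta> i < wt (insert r (N - U)) i"
    using assms(2) U by (meson le_less_trans subsetD)
qed

lemma parking_cong:
  assumes "\<And>i. i \<in> N \<Longrightarrow> \<alpha> i = \<beta> i"
  shows "parking N \<alpha> \<longleftrightarrow> parking N \<beta>"
  using assms parking_antimono[of N \<alpha> \<beta>] parking_antimono[of N \<beta> \<alpha>] by auto

text \<open>The parking condition is applied to the complement of the component \<open>reach (N - T)\<close>. A vertex of that
  complement outside \<open>T\<close> has no edge into the component, so the condition must hold at a vertex of \<open>T\<close>.\<close>

lemma parking_reachD:
  assumes r: "r \<notin> N" and pk: "parking N \<alpha>" and T: "T \<subseteq> N" "T \<noteq> {}"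
  shows "\<exists>i\<in>T. \<alpha> i < wt (reach (N - T)) i"
proof -
  define U where "U = N - reach (N - T)"
  have TU: "T \<subseteq> U" using T r reach_subset[of "N - T"] unfolding U_def by auto
  have eq: "insert r (N - U) = reach (N - T)"
    using reach_subset[of "N - T"] reach.root[of "N - T"] unfolding U_def by auto
  have "U \<subseteq> N" "U \<noteq> {}" using TU T unfolding U_def by auto
  then obtain i where i: "i \<in> U" "\<alpha> i < wt (reach (N - T)) i"
    using pk eq unfolding parking_def by metis
  have "i \<in> T"
  proof (rule ccontr)
    assume "i \<notin> T"
    from i obtain j where "j \<in> reach (N - T)" "w i j > 0"
      using wt_posE[of "reach (N - T)" i] by (metis gr_zeroI not_less0)
    then have "i \<in> reach (N - T)"
      using i \<open>i \<notin> T\<close> by (auto simp: U_def intro: reach.step)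
    then show False using i by (simp add: U_def)
  qed
  then show ?thesis using i by blast
qed

text \<open>A converse of \<open>parking_reachD\<close>: only subsets of the support \<open>S\<close> have to be tested. Given \<open>U\<close>, put
  \<open>T = U \<inter> S\<close>. Either the component \<open>reach (N - T)\<close> enters \<open>U\<close>, and then it does so at a vertex
  where \<open>\<alpha>\<close> is zero, or it lies outside \<open>U\<close>, and then the condition for \<open>T\<close> implies the one for \<open>U\<close>.\<close>

lemma parking_reachI:
  assumes fin: "finite N" and r: "r \<notin> N" and full: "N \<subseteq> reach N"
    and S: "S \<subseteq> N" "\<And>i. i \<in> N - S \<Longrightarrow> \<alpha> i = 0"
    and T: "\<And>T. T \<subseteq> S \<Longrightarrow> T \<noteq> {} \<Longrightarrow> \<exists>i\<in>T. \<alpha> i < wt (reach (N - T)) i"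
  shows "parking N \<alpha>"
  unfolding parking_def
proof (intro allI impI)
  fix U assume U: "U \<subseteq> N" "U \<noteq> {}"
  let ?T = "U \<inter> S"
  show "\<exists>i\<in>U. \<alpha> i < wt (insert r (N - U)) i"
  proof (cases "U \<inter> reach (N - ?T) = {}")
    case False
    then obtain j u where j: "j \<in> U" "j \<in> reach (N - ?T)" "u \<in> reach (N - ?T) - U" "w j u > 0"
      using reach_first_hit[of _ "N - ?T" U] U r by blast
    have "j \<notin> S" using j(1,2) reach_subset[of "N - ?T"] U r by auto
    then have "\<alpha> j = 0" using S j(1) U by auto
    moreover have "u \<in> insert r (N - U)" using j(3) reach_subset[of "N - ?T"] by auto
    then have "wt (insert r (N - U)) j > 0"
      using wt_ge[of "insert r (N - U)" u j] fin j(4) by simp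
    ultimately show ?thesis using j(1) by (intro bexI[of _ j]) simp_all
  next
    case True
    have "?T \<noteq> {}"
    proof
      assume "?T = {}"
      then have "N - ?T = N" by auto
      then show False using True full U by auto
    qed
    then obtain i where i: "i \<in> ?T" "\<alpha> i < wt (reach (N - ?T)) i" using T[of ?T] by auto
    have "reach (N - ?T) \<subseteq> insert r (N - U)" using True reach_subset[of "N - ?T"] by auto
    then have "wt (reach (N - ?T)) i \<le> wt (insert r (N - U)) i"
      using fin by (intro wt_mono) auto
    then show ?thesis using i by (meson IntD1 less_le_trans)
  qed
qed

lemma reach_full_iff_parking_zero:
  assumes "finite N" "r \<notin> N"
  shows "N \<subseteq> reach N \<longleftrightarrow> parking N (\<lambda>_. 0)"
proof
  assume "N \<subseteq> reach N" then show "parking N (\<lambda>_. 0)"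
    by (intro parking_reachI[where S = "{}"] assms) auto
next
  assume pk: "parking N (\<lambda>_. 0)"
  show "N \<subseteq> reach N"
  proof (rule ccontr)
    assume "\<not> N \<subseteq> reach N"
    then have "N - reach N \<noteq> {}" by auto
    then obtain i where i: "i \<in> N - reach N" "0 < wt (insert r (N - (N - reach N))) i"
      using pk unfolding parking_def by (meson Diff_subset)
    from wt_posE[OF i(2)] obtain j where "j \<in> insert r (N - (N - reach N))" "w i j > 0" .
    then have "i \<in> reach N" using i(1) reach.root by (auto intro: reach.step)
    then show False using i by simp
  qed
qed

lemma reach_wt_pos:
  assumes "finite N" "r \<notin> N" "N \<subseteq> reach N" "i \<in> N"
  shows "wt (reach (N - {i})) i > 0"
  using parking_reachD[of N "\<lambda>_. 0" "{i}"] reach_full_iff_parking_zero[of N] assms by auto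

lemma reach_Diff_unreached:
  assumes "k \<notin> reach N" shows "reach (N - {k}) = reach N"
proof
  show "reach N \<subseteq> reach (N - {k})"
  proof
    fix v assume "v \<in> reach N"
    then show "v \<in> reach (N - {k})"
    proof induction
      case (step u v)
      then have "v \<noteq> k" using assms reach.step by metis
      then show ?case using step by (auto intro: reach.step)
    qed (rule reach.root)
  qed
qed (simp add: reach_mono)

text \<open>If each of \<open>p\<close> and \<open>q\<close> separated the other from the root, then a path from the root could
  reach neither of them first.\<close>

lemma reach_linear:
  assumes "N \<subseteq> reach N" "r \<notin> N" "p \<in> N" "q \<in> N" "p \<noteq> q"
  shows "p \<in> reach (N - {q}) \<or> q \<in> reach (N - {p})"
proof (rule ccontr)
  assume n: "\<not> ?thesis"
  have "reach (N - {p} - {q}) = reach (N - {p})" by (rule reach_Diff_unreached) (use n in simp)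
  moreover have "reach (N - {q} - {p}) = reach (N - {q})"
    by (rule reach_Diff_unreached) (use n in simp)
  moreover have "N - {p} - {q} = N - {q} - {p}" by auto
  ultimately have eq: "reach (N - {p}) = reach (N - {q})" by simp
  have "p \<in> reach N" using assms by auto
  then obtain j u where j: "j \<in> {p, q}" "u \<in> reach N - {p, q}" "w j u > 0"
    using reach_first_hit[of p N "{p, q}"] assms by blast
  have *: "v \<in> reach (N - {p})" if "v \<in> reach N" for v
    using that
  proof induction
    case (step u v)
    show ?case
    proof (cases "v = p")
      case True
      then have "v \<in> reach (N - {q})"
        using step assms eq by (auto intro: reach.step)
      then show ?thesis using eq by simp
    next
      case False
      then show ?thesis using step by (auto intro: reach.step)
    qed
  qed (rule reach.root)
  then show False using n eq assms by blast
qed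

section \<open>Invariance forces one of two types\<close>

definition parking_invariant :: "'v set \<Rightarrow> bool" where
  "parking_invariant N \<longleftrightarrow>
     (\<forall>\<sigma> \<alpha>. \<sigma> permutes N \<longrightarrow> parking N \<alpha> \<longrightarrow> parking N (\<lambda>x. \<alpha> (\<sigma> x)))"

lemma invariant_transpose:
  assumes "parking_invariant N" "p \<in> N" "q \<in> N" "parking N \<alpha>"
  shows "parking N (\<lambda>x. \<alpha> (transpose p q x))"
  using assms permutes_swap_id[of p N q] unfolding parking_invariant_def by blast

lemma invariant_single:
  assumes inv: "parking_invariant N" and N: "p \<in> N" "p' \<in> N"
    and pk: "parking N ((\<lambda>_. 0)(p := c))"
  shows "parking N ((\<lambda>_. 0)(p' := c))"
proof -
  have "(\<lambda>x. ((\<lambda>_. 0)(p := c)) (transpose p p' x)) = (\<lambda>_. 0)(p' := c)"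
    by (auto simp: transpose_def)
  then show ?thesis using invariant_transpose[OF inv N pk] by metis
qed

text \<open>Two transpositions move an ordered pair to any other ordered pair: the first one takes \<open>p\<close> to \<open>p'\<close>
  and \<open>q\<close> to some \<open>s\<close>, the second one takes \<open>s\<close> to \<open>q'\<close>.\<close>

lemma invariant_pair:
  assumes inv: "parking_invariant N"
    and N: "p \<in> N" "q \<in> N" "p \<noteq> q" "p' \<in> N" "q' \<in> N" "p' \<noteq> q'"
    and pk: "parking N ((\<lambda>_. 0)(p := c, q := d))"
  shows "parking N ((\<lambda>_. 0)(p' := c, q' := d))"
proof -
  define s where "s = transpose p p' q"
  have s: "s \<in> N" "s \<noteq> p'" using N by (auto simp: s_def transpose_def)
  have "(\<lambda>x. ((\<lambda>_. 0)(p := c, q := d)) (transpose p p' x)) = (\<lambda>_. 0)(p' := c, s := d)"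
    using N by (auto simp: transpose_def s_def)
  then have 1: "parking N ((\<lambda>_. 0)(p' := c, s := d))"
    using invariant_transpose[OF inv N(1,4) pk] by metis
  have "(\<lambda>x. ((\<lambda>_. 0)(p' := c, s := d)) (transpose s q' x)) = (\<lambda>_. 0)(p' := c, q' := d)"
    using N s by (auto simp: transpose_def)
  then show ?thesis using invariant_transpose[OF inv s(1) N(5) 1] by metis
qed

lemma parking_single_iff:
  assumes "finite N" "r \<notin> N" "N \<subseteq> reach N" "i \<in> N"
  shows "parking N ((\<lambda>_. 0)(i := c)) \<longleftrightarrow> c < wt (reach (N - {i})) i"
proof
  assume "parking N ((\<lambda>_. 0)(i := c))"
  from parking_reachD[OF assms(2) this, of "{i}"] show "c < wt (reach (N - {i})) i"
    using assms by simp
next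
  assume c: "c < wt (reach (N - {i})) i"
  show "parking N ((\<lambda>_. 0)(i := c))"
  proof (rule parking_reachI[OF assms(1-3), where S = "{i}"])
    fix T assume "T \<subseteq> {i}" "T \<noteq> {}"
    then have "T = {i}" by auto
    then show "\<exists>ia\<in>T. ((\<lambda>_. 0)(i := c)) ia < wt (reach (N - T)) ia" using c by simp
  qed (use assms in auto)
qed

lemma parking_pair_iff:
  assumes "finite N" "r \<notin> N" "N \<subseteq> reach N" "p \<in> N" "q \<in> N" "p \<noteq> q"
    and c: "c < wt (reach (N - {p})) p" and d: "d < wt (reach (N - {q})) q"
  shows "parking N ((\<lambda>_. 0)(p := c, q := d)) \<longleftrightarrow>
    c < wt (reach (N - {p, q})) p \<or> d < wt (reach (N - {p, q})) q"
proof
  assume "parking N ((\<lambda>_. 0)(p := c, q := d))"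
  from parking_reachD[OF assms(2) this, of "{p, q}"]
  show "c < wt (reach (N - {p, q})) p \<or> d < wt (reach (N - {p, q})) q"
    using assms by auto
next
  assume e: "c < wt (reach (N - {p, q})) p \<or> d < wt (reach (N - {p, q})) q"
  show "parking N ((\<lambda>_. 0)(p := c, q := d))"
  proof (rule parking_reachI[OF assms(1-3), where S = "{p, q}"])
    fix T assume "T \<subseteq> {p, q}" "T \<noteq> {}"
    then have "T = {p} \<or> T = {q} \<or> T = {p, q}" by auto
    then show "\<exists>i\<in>T. ((\<lambda>_. 0)(p := c, q := d)) i < wt (reach (N - T)) i"
      using c d e assms(6) by auto
  qed (use assms in auto)
qed

text \<open>For a connected graph, both types record which vectors supported on at most two vertices are parking.
  The vector
  \<open>(M - 1, M - 1)\<close> on \<open>{p, q}\<close> is parking for all pairs in the first type and for no pair in the second.\<close>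

definition tree_type :: "'v set \<Rightarrow> nat \<Rightarrow> bool" where
  "tree_type N M \<longleftrightarrow> (\<forall>i\<in>N. wt (reach (N - {i})) i = M) \<and>
     (\<forall>p\<in>N. \<forall>q\<in>N. p \<noteq> q \<longrightarrow>
        M \<le> wt (reach (N - {p, q})) p \<or> M \<le> wt (reach (N - {p, q})) q)"

definition uniform_type :: "'v set \<Rightarrow> nat \<Rightarrow> nat \<Rightarrow> bool" where
  "uniform_type N M A \<longleftrightarrow> (\<forall>i\<in>N. wt (reach (N - {i})) i = M) \<and> A < M \<and>
     (\<forall>p\<in>N. \<forall>q\<in>N. p \<noteq> q \<longrightarrow> wt (reach (N - {p, q})) p = A)"

text \<open>Whether \<open>(M - 1, M - 1)\<close> on \<open>{p, q}\<close> is parking does not depend on the pair, by invariance. If it is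
  not parking, then \<open>(c, M - 1)\<close> on \<open>(p, q)\<close> is parking for exactly those \<open>c\<close> below the number of edges
  from \<open>p\<close> to \<open>reach (N - {p, q})\<close>, which is therefore the same for all ordered pairs.\<close>

lemma invariant_cases:
  assumes fin: "finite N" and r: "r \<notin> N" and full: "N \<subseteq> reach N" and inv: "parking_invariant N"
    and ne: "N \<noteq> {}"
  obtains (tree) M where "M > 0" "tree_type N M"
  | (uniform) M A p q where "p \<in> N" "q \<in> N" "p \<noteq> q" "uniform_type N M A"
proof -
  obtain i0 where i0: "i0 \<in> N" using ne by auto
  define M where "M = wt (reach (N - {i0})) i0"
  have M: "wt (reach (N - {i})) i = M" if i: "i \<in> N" for i
  proof -
    have "c < wt (reach (N - {i})) i \<longleftrightarrow> c < M" for c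
      using parking_single_iff[OF fin r full] i i0 invariant_single[OF inv] unfolding M_def by blast
    then show ?thesis by (metis linorder_neqE_nat less_irrefl)
  qed
  have Mpos: "M > 0" unfolding M_def by (rule reach_wt_pos[OF fin r full i0])
  have pair: "parking N ((\<lambda>_. 0)(p := c, q := d)) \<longleftrightarrow>
      c < wt (reach (N - {p, q})) p \<or> d < wt (reach (N - {p, q})) q"
    if "p \<in> N" "q \<in> N" "p \<noteq> q" "c < M" "d < M" for p q c d
    using that M by (intro parking_pair_iff[OF fin r full]) auto
  show thesis
  proof (cases "tree_type N M")
    case True then show ?thesis using tree Mpos by blast
  next
    case False
    then obtain p q where pq: "p \<in> N" "q \<in> N" "p \<noteq> q"
      "wt (reach (N - {p, q})) p < M" "wt (reach (N - {p, q})) q < M"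
      using M unfolding tree_type_def by (auto simp: not_le)
    define A where "A = wt (reach (N - {p, q})) p"
    have low: "wt (reach (N - {p', q'})) p' < M \<and> wt (reach (N - {p', q'})) q' < M"
      if pq': "p' \<in> N" "q' \<in> N" "p' \<noteq> q'" for p' q'
    proof (rule ccontr)
      assume "\<not> ?thesis"
      then have "parking N ((\<lambda>_. 0)(p' := M - 1, q' := M - 1))"
        using pair[OF pq', of "M - 1" "M - 1"] Mpos by auto
      then have "parking N ((\<lambda>_. 0)(p := M - 1, q := M - 1))"
        using invariant_pair[OF inv pq' pq(1-3)] by blast
      then show False using pair[OF pq(1-3), of "M - 1" "M - 1"] Mpos pq by auto
    qed
    have val: "c < wt (reach (N - {p', q'})) p' \<longleftrightarrow> parking N ((\<lambda>_. 0)(p' := c, q' := M - 1))"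
      if pq': "p' \<in> N" "q' \<in> N" "p' \<noteq> q'" "c < M" for p' q' c
      using pair[OF pq', of "M - 1"] low[OF pq'(1-3)] Mpos by auto
    have "wt (reach (N - {p', q'})) p' = A" if pq': "p' \<in> N" "q' \<in> N" "p' \<noteq> q'" for p' q'
    proof -
      have "c < wt (reach (N - {p', q'})) p' \<longleftrightarrow> c < A" if "c < M" for c
        using val[OF pq' that] val[OF pq(1-3) that]
          invariant_pair[OF inv pq' pq(1-3)] invariant_pair[OF inv pq(1-3) pq'] A_def by blast
      then show ?thesis
        by (metis A_def low[OF pq'] pq(4) linorder_neqE_nat less_irrefl)
    qed
    then have "uniform_type N M A" using M pq A_def unfolding uniform_type_def by blast
    then show ?thesis using uniform pq by blast
  qed
qed

section \<open>Trees\<close>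

text \<open>Of the two vertices, let \<open>x\<close> be one with \<open>M\<close> or more edges to \<open>reach (N - {p, q})\<close>, and \<open>y\<close> the other. If \<open>y\<close>
  could be reached avoiding \<open>x\<close>, the edges between them would push the number of edges from \<open>x\<close> to
  \<open>reach (N - {x})\<close> above \<open>M\<close>.\<close>

lemma tree_type_adjacent:
  assumes fin: "finite N" and r: "r \<notin> N" and T: "tree_type N M" and pq: "p \<in> N" "q \<in> N" "w p q > 0"
  shows "q \<notin> reach (N - {p}) \<or> p \<notin> reach (N - {q})"
proof -
  have ne: "p \<noteq> q" using pq loopless[of p] by auto
  have *: "y \<notin> reach (N - {x})"
    if xy: "x \<in> N" "y \<in> N" "w x y > 0" "x \<noteq> y" and M: "M \<le> wt (reach (N - {x, y})) x" "y \<noteq> r"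
    for x y
  proof
    assume y: "y \<in> reach (N - {x})"
    have "y \<notin> reach (N - {x, y})" using reach_subset[of "N - {x, y}"] M(2) by auto
    then have "wt (insert y (reach (N - {x, y}))) x = w x y + wt (reach (N - {x, y})) x"
      by (intro wt_insert) (auto intro: finite_reach fin)
    moreover have "insert y (reach (N - {x, y})) \<subseteq> reach (N - {x})"
      using y reach_mono[of "N - {x, y}" "N - {x}"] by auto
    then have "wt (insert y (reach (N - {x, y}))) x \<le> wt (reach (N - {x})) x"
      by (intro wt_mono finite_reach) (use fin in auto)
    moreover have "wt (reach (N - {x})) x = M" using T xy unfolding tree_type_def by blast
    ultimately show False using xy M by simp
  qed
  have "M \<le> wt (reach (N - {p, q})) p \<or> M \<le> wt (reach (N - {p, q})) q"
    using T pq ne by (simp add: tree_type_def)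
  moreover have "{p, q} = {q, p}" by auto
  ultimately have "M \<le> wt (reach (N - {p, q})) p \<or> M \<le> wt (reach (N - {q, p})) q" by metis
  then show ?thesis using *[of p q] *[of q p] pq ne r sym[of p q] by auto
qed

text \<open>If \<open>i\<close> had two neighbours in \<open>reach (N - {i})\<close>, then \<open>i\<close> would be separated from the root by each of them other than
  the root. So each would also separate the other one from the root, contradicting \<open>reach_linear\<close>.\<close>

lemma tree_type_unique_parent:
  assumes fin: "finite N" and r: "r \<notin> N" and full: "N \<subseteq> reach N" and T: "tree_type N M"
    and i: "i \<in> N" and j1: "j1 \<in> reach (N - {i})" "w i j1 > 0"
    and j2: "j2 \<in> reach (N - {i})" "w i j2 > 0"
  shows "j1 = j2"
proof (rule ccontr)
  assume ne: "j1 \<noteq> j2"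
  have *: "y \<notin> reach (N - {x})"
    if x: "x \<in> reach (N - {i})" "w i x > 0" "x \<noteq> r" and y: "w i y > 0" for x y
  proof
    assume "y \<in> reach (N - {x})"
    moreover have "x \<in> N" "x \<noteq> i" using x reach_subset[of "N - {i}"] by auto
    ultimately have "i \<in> reach (N - {x})" using i y by (auto intro: reach.step)
    then show False using tree_type_adjacent[OF fin r T i \<open>x \<in> N\<close> x(2)] x(1) by blast
  qed
  have nr: "j1 \<noteq> r" "j2 \<noteq> r"
    using *[OF j1 _ j2(2)] *[OF j2 _ j1(2)] ne reach.root by metis+
  then have "j1 \<in> N" "j2 \<in> N"
    using j1 j2 reach_subset[of "N - {i}"] by auto
  then show False
    using reach_linear[OF full r _ _ ne] *[OF j1 nr(1) j2(2)] *[OF j2 nr(2) j1(2)] by blast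
qed

lemma tree_type_parent_weight:
  assumes fin: "finite N" and r: "r \<notin> N" and full: "N \<subseteq> reach N" and T: "tree_type N M"
    and i: "i \<in> N" and j: "j \<in> reach (N - {i})" "w i j > 0"
  shows "w i j = M"
proof -
  have "wt (reach (N - {i})) i = (\<Sum>k\<in>reach (N - {i}). if k = j then w i j else 0)"
    unfolding wt_def
  proof (rule sum.cong[OF refl])
    fix k assume "k \<in> reach (N - {i})"
    then have "w i k > 0 \<Longrightarrow> k = j"
      by (rule tree_type_unique_parent[OF fin r full T i _ _ j])
    then show "w i k = (if k = j then w i j else 0)" by (cases "w i k = 0") (use j in auto)
  qed
  also have "\<dots> = w i j" using j finite_reach[of "N - {i}"] fin by simp
  finally show ?thesis using T i unfolding tree_type_def by auto
qed

text \<open>This orients every edge of a graph of tree type, from a vertex \<open>u\<close> to its parent \<open>v\<close>.\<close>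

definition parent_weight :: "'v set \<Rightarrow> 'v \<Rightarrow> 'v \<Rightarrow> nat" where
  "parent_weight N u v = (if u \<in> N \<and> v \<in> reach (N - {u}) then w u v else 0)"

lemma tree_type_edge_oriented:
  assumes fin: "finite N" and r: "r \<notin> N" and full: "N \<subseteq> reach N" and T: "tree_type N M"
    and uv: "u \<in> insert r N" "v \<in> insert r N"
  shows "w u v = parent_weight N u v + parent_weight N v u"
proof (cases "w u v = 0")
  case True
  then show ?thesis using sym[of u v] by (simp add: parent_weight_def)
next
  case False
  then have ne: "u \<noteq> v" using loopless[of u] by auto
  show ?thesis
  proof (cases "u = r \<or> v = r")
    case True
    then show ?thesis using uv r ne sym[of u v] reach.root by (auto simp: parent_weight_def)
  next
    case F: False
    then have N: "u \<in> N" "v \<in> N" using uv by auto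
    show ?thesis
      using reach_linear[OF full r N ne] tree_type_adjacent[OF fin r T N] False N sym[of u v]
      by (auto simp: parent_weight_def)
  qed
qed

lemma tree_type_weights:
  assumes fin: "finite N" and r: "r \<notin> N" and full: "N \<subseteq> reach N" and T: "tree_type N M"
    and uv: "u \<in> insert r N" "v \<in> insert r N"
  shows "w u v \<in> {0, M}"
proof -
  have "parent_weight N x y \<in> {0, M}" for x y
    using tree_type_parent_weight[OF fin r full T, of x y] by (auto simp: parent_weight_def)
  moreover have "parent_weight N u v = 0 \<or> parent_weight N v u = 0"
    using tree_type_adjacent[OF fin r T, of u v] r reach_subset[of "N - {u}"] reach_subset[of "N - {v}"]
    by (auto simp: parent_weight_def)
  ultimately show ?thesis
    unfolding tree_type_edge_oriented[OF fin r full T uv] by (metis add_0 add_0_right)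
qed

text \<open>Twice the number of edges, since the sum runs over ordered pairs of vertices.\<close>

definition total_weight :: "'v set \<Rightarrow> nat" where
  "total_weight N = (\<Sum>u\<in>insert r N. wt (insert r N) u)"

lemma tree_type_total_weight:
  assumes fin: "finite N" and r: "r \<notin> N" and full: "N \<subseteq> reach N" and T: "tree_type N M"
  shows "total_weight N = 2 * M * card N"
proof -
  let ?V = "insert r N"
  have "total_weight N = (\<Sum>u\<in>?V. \<Sum>v\<in>?V. parent_weight N u v + parent_weight N v u)"
    unfolding total_weight_def wt_def
    by (intro sum.cong refl tree_type_edge_oriented[OF fin r full T])
  also have "\<dots> = (\<Sum>u\<in>?V. \<Sum>v\<in>?V. parent_weight N u v) + (\<Sum>u\<in>?V. \<Sum>v\<in>?V. parent_weight N v u)"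
    by (simp only: sum.distrib)
  also have "(\<Sum>u\<in>?V. \<Sum>v\<in>?V. parent_weight N v u) = (\<Sum>u\<in>?V. \<Sum>v\<in>?V. parent_weight N u v)"
    by (rule sum.swap)
  also have "(\<Sum>u\<in>?V. \<Sum>v\<in>?V. parent_weight N u v) = (\<Sum>u\<in>N. \<Sum>v\<in>?V. parent_weight N u v)"
    using fin r by (simp add: parent_weight_def)
  also have "\<dots> = (\<Sum>u\<in>N. M)"
  proof (rule sum.cong[OF refl])
    fix u assume u: "u \<in> N"
    have sub: "reach (N - {u}) \<subseteq> ?V" using reach_subset[of "N - {u}"] by auto
    have "(\<Sum>v\<in>?V. parent_weight N u v) = (\<Sum>v\<in>reach (N - {u}). w u v)"
      using u fin sub by (intro sum.mono_neutral_cong_right) (auto simp: parent_weight_def)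
    then show "(\<Sum>v\<in>?V. parent_weight N u v) = M"
      using T u by (simp add: tree_type_def wt_def)
  qed
  finally show ?thesis by simp
qed

lemma tree_type_parking_iff:
  assumes fin: "finite N" and r: "r \<notin> N" and full: "N \<subseteq> reach N" and T: "tree_type N M"
  shows "parking N \<alpha> \<longleftrightarrow> (\<forall>i\<in>N. \<alpha> i < M)"
proof
  assume pk: "parking N \<alpha>"
  show "\<forall>i\<in>N. \<alpha> i < M"
  proof
    fix i assume "i \<in> N"
    then show "\<alpha> i < M" using parking_reachD[OF r pk, of "{i}"] T by (auto simp: tree_type_def)
  qed
next
  assume le: "\<forall>i\<in>N. \<alpha> i < M"
  show "parking N \<alpha>"
    unfolding parking_def
  proof (intro allI impI)
    fix U assume U: "U \<subseteq> N" "U \<noteq> {}"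
    have "parking N (\<lambda>_. 0)" using full reach_full_iff_parking_zero[OF fin r] by simp
    then obtain i where i: "i \<in> U" "0 < wt (insert r (N - U)) i"
      using U unfolding parking_def by blast
    from wt_posE[OF i(2)] obtain j where j: "j \<in> insert r (N - U)" "w i j > 0" .
    then have "w i j = M" using tree_type_weights[OF fin r full T, of i j] i U by auto
    then have "M \<le> wt (insert r (N - U)) i" using wt_ge[of "insert r (N - U)" j i] fin j by auto
    moreover have "\<alpha> i < M" using le i U by blast
    ultimately show "\<exists>i\<in>U. \<alpha> i < wt (insert r (N - U)) i" using i by (meson less_le_trans)
  qed
qed

section \<open>Complete multigraphs and cycles\<close>

text \<open>If \<open>k\<close> were unreachable in the absence of \<open>i\<close>, then deleting \<open>k\<close> as well would change nothing,
  and \<open>M = A\<close>.\<close>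

lemma uniform_type_delete_reach:
  assumes C: "uniform_type N M A" and i: "i \<in> N"
  shows "N - {i} \<subseteq> reach (N - {i})"
proof
  fix k assume k: "k \<in> N - {i}"
  show "k \<in> reach (N - {i})"
  proof (rule ccontr)
    assume "k \<notin> reach (N - {i})"
    then have "reach (N - {i} - {k}) = reach (N - {i})" by (rule reach_Diff_unreached)
    moreover have "N - {i} - {k} = N - {i, k}" by auto
    ultimately have "wt (reach (N - {i, k})) i = M" using C i by (simp add: uniform_type_def)
    then show False using C i k by (auto simp: uniform_type_def)
  qed
qed

lemma uniform_type_degree:
  assumes C: "uniform_type N M A" and i: "i \<in> N"
  shows "wt (insert r (N - {i})) i = M"
proof -
  have "wt (reach (N - {i})) i = M" using C i by (simp add: uniform_type_def)
  then show ?thesis unfolding reach_full[OF uniform_type_delete_reach[OF C i]] .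
qed

text \<open>Since \<open>M\<close> is the degree of \<open>i\<close>, an entry \<open>M - 1\<close> at \<open>i\<close> satisfies the bound for a set containing \<open>i\<close>
  only if \<open>i\<close> has no neighbour in that set. The remaining entries are thus constrained as if \<open>i\<close> were
  deleted.\<close>

lemma uniform_type_parking_delete:
  assumes fin: "finite N" and r: "r \<notin> N" and C: "uniform_type N M A" and i: "i \<in> N"
  shows "parking (N - {i}) \<alpha> \<longleftrightarrow> parking N (\<alpha>(i := M - 1))"
proof
  assume pk: "parking N (\<alpha>(i := M - 1))"
  show "parking (N - {i}) \<alpha>"
    unfolding parking_def
  proof (intro allI impI)
    fix U assume U: "U \<subseteq> N - {i}" "U \<noteq> {}"
    show "\<exists>j\<in>U. \<alpha> j < wt (insert r (N - {i} - U)) j"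
    \<comment> \<open>If \<open>i\<close> has no neighbour in \<open>U\<close>, the set \<open>U\<close> itself is tested in the larger graph; otherwise \<open>insert i U\<close>.\<close>
    proof (cases "\<forall>u\<in>U. w i u = 0")
      case True
      obtain j where j: "j \<in> U" "(\<alpha>(i := M - 1)) j < wt (insert r (N - U)) j"
        using pk U unfolding parking_def by (metis Diff_subset subset_trans)
      have "insert r (N - U) = insert i (insert r (N - {i} - U))" using i U by auto
      then have "wt (insert r (N - U)) j = w j i + wt (insert r (N - {i} - U)) j"
        using fin i r wt_insert[of "insert r (N - {i} - U)" i j] by auto
      moreover have "w j i = 0" using True j(1) sym[of i j] by simp
      moreover have "j \<noteq> i" using j U by auto
      ultimately show ?thesis using j by auto
    next
      case False
      then obtain u where u: "u \<in> U" "w i u > 0" by auto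
      have "insert i U \<subseteq> N" "insert i U \<noteq> {}" using U i by auto
      then obtain j where j: "j \<in> insert i U" "(\<alpha>(i := M - 1)) j < wt (insert r (N - insert i U)) j"
        using pk unfolding parking_def by blast
      have eq: "N - insert i U = N - {i} - U" by auto
      have "j \<noteq> i"
      proof
        assume "j = i"
        then have "M - 1 < wt (insert r (N - {i} - U)) i" using j eq by simp
        moreover have "u \<notin> insert r (N - {i} - U)" using u U r by auto
        then have "wt (insert u (insert r (N - {i} - U))) i = w i u + wt (insert r (N - {i} - U)) i"
          using fin by (intro wt_insert) auto
        moreover have "wt (insert u (insert r (N - {i} - U))) i \<le> wt (insert r (N - {i})) i"
          using fin u U by (intro wt_mono) auto
        ultimately show False using u uniform_type_degree[OF C i] by simp
      qed
      then show ?thesis using j eq by auto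
    qed
  qed
next
  assume pk: "parking (N - {i}) \<alpha>"
  have M: "M > 0" using C by (auto simp: uniform_type_def)
  show "parking N (\<alpha>(i := M - 1))"
    unfolding parking_def
  proof (intro allI impI)
    fix U assume U: "U \<subseteq> N" "U \<noteq> {}"
    show "\<exists>j\<in>U. (\<alpha>(i := M - 1)) j < wt (insert r (N - U)) j"
    proof (cases "U = {i}")
      case True
      then show ?thesis using uniform_type_degree[OF C i] M by simp
    next
      case False
      then have "U - {i} \<subseteq> N - {i}" "U - {i} \<noteq> {}" using U by auto
      then obtain j where j: "j \<in> U - {i}" "\<alpha> j < wt (insert r (N - {i} - (U - {i}))) j"
        using pk unfolding parking_def by blast
      moreover have "wt (insert r (N - {i} - (U - {i}))) j \<le> wt (insert r (N - U)) j"
        using fin by (intro wt_mono) auto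
      ultimately have "(\<alpha>(i := M - 1)) j < wt (insert r (N - U)) j" by auto
      then show ?thesis using j by blast
    qed
  qed
qed

lemma uniform_type_invariant_delete:
  assumes fin: "finite N" and r: "r \<notin> N" and C: "uniform_type N M A" and i: "i \<in> N"
    and inv: "parking_invariant N"
  shows "parking_invariant (N - {i})"
  unfolding parking_invariant_def
proof (intro allI impI)
  fix \<sigma> \<alpha> assume s: "\<sigma> permutes N - {i}" and pk: "parking (N - {i}) \<alpha>"
  have sN: "\<sigma> permutes N" using s by (rule permutes_subset) auto
  have "parking N (\<lambda>x. (\<alpha>(i := M - 1)) (\<sigma> x))"
    using inv sN pk uniform_type_parking_delete[OF fin r C i] unfolding parking_invariant_def by blast
  moreover have "(\<lambda>x. (\<alpha>(i := M - 1)) (\<sigma> x)) = (\<lambda>x. \<alpha> (\<sigma> x))(i := M - 1)"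
  proof
    fix x
    have "\<sigma> i = i" using s by (rule permutes_not_in) auto
    moreover have "\<sigma> x = i \<longleftrightarrow> x = i" using \<open>\<sigma> i = i\<close> permutes_inj[OF s] by (metis injD)
    ultimately show "(\<alpha>(i := M - 1)) (\<sigma> x) = ((\<lambda>x. \<alpha> (\<sigma> x))(i := M - 1)) x" by simp
  qed
  ultimately show "parking (N - {i}) (\<lambda>x. \<alpha> (\<sigma> x))"
    using uniform_type_parking_delete[OF fin r C i] by metis
qed

lemma uniform_type_low_weight:
  assumes C: "uniform_type N M A"
    and pq: "p \<in> N" "q \<in> N" "p \<noteq> q"
  shows "wt (reach (N - {p} - {q})) q = A"
proof -
  have "N - {p} - {q} = N - {q, p}" by auto
  then show ?thesis using C pq by (auto simp: uniform_type_def)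
qed

lemma uniform_type_low_pos:
  assumes fin: "finite N" and r: "r \<notin> N" and C: "uniform_type N M A"
    and pq: "p \<in> N" "q \<in> N" "p \<noteq> q"
  shows "A > 0"
  using reach_wt_pos[of "N - {p}" q] uniform_type_delete_reach[OF C pq(1)]
    uniform_type_low_weight[OF C pq] fin r pq by auto

text \<open>Both \<open>reach (N - {p})\<close> and \<open>reach (N - {p, q})\<close> are as large as possible here, so \<open>w p q\<close> is the difference
  \<open>M - A\<close> of the two numbers of edges from \<open>p\<close>. The edges to the root make up the rest of the degree \<open>M\<close>.\<close>

lemma uniform_type_complete:
  assumes fin: "finite N" and r: "r \<notin> N" and full: "N \<subseteq> reach N" and C: "uniform_type N M A"
    and ne: "N \<noteq> {}"
    and two: "\<And>p q. p \<in> N \<Longrightarrow> q \<in> N \<Longrightarrow> p \<noteq> q \<Longrightarrow> N - {p, q} \<subseteq> reach (N - {p, q})"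
  obtains a b where "a > 0" "b > 0" "\<And>p. p \<in> N \<Longrightarrow> w p r = a"
    "\<And>p q. p \<in> N \<Longrightarrow> q \<in> N \<Longrightarrow> p \<noteq> q \<Longrightarrow> w p q = b"
proof -
  define b where "b = M - A"
  have b: "b > 0" using C by (auto simp: b_def uniform_type_def)
  have wb: "w p q = b" if pq: "p \<in> N" "q \<in> N" "p \<noteq> q" for p q
  proof -
    have "wt (insert r (N - {p, q})) p = A"
      using C pq unfolding reach_full[OF two[OF pq], symmetric] uniform_type_def by blast
    moreover have "insert r (N - {p}) = insert q (insert r (N - {p, q}))" using pq by auto
    then have "wt (insert r (N - {p})) p = w p q + wt (insert r (N - {p, q})) p"
      using fin pq r by (metis (no_types, lifting) Diff_iff finite.insertI finite_Diff insertE insertI1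
          insertI2 wt_insert)
    ultimately show ?thesis using uniform_type_degree[OF C pq(1)] by (simp add: b_def)
  qed
  have deg: "w p r + (card N - 1) * b = M" if p: "p \<in> N" for p
  proof -
    have "wt (N - {p}) p = (\<Sum>q\<in>N - {p}. b)"
      unfolding wt_def using wb[OF p] by (intro sum.cong) auto
    then have "wt (N - {p}) p = (card N - 1) * b" using fin p by simp
    then show ?thesis
      using uniform_type_degree[OF C p] fin r by (simp add: wt_insert)
  qed
  define a where "a = M - (card N - 1) * b"
  have wa: "w p r = a" if "p \<in> N" for p using deg[OF that] by (simp add: a_def)
  have "parking N (\<lambda>_. 0)" using full reach_full_iff_parking_zero[OF fin r] by simp
  then obtain i where i: "i \<in> N" "0 < wt (insert r (N - N)) i"
    using ne unfolding parking_def by blast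
  then have "a > 0" using wa[OF i(1)] by (simp add: wt_def)
  then show thesis using that b wa wb by blast
qed

text \<open>Deleting the vertex \<open>p\<close> leaves a graph that deleting \<open>q\<close> disconnects, so it cannot have uniform type.
  By invariance, every graph with one non-root vertex deleted then has tree type with constant \<open>A\<close>, which determines its number of edges. With \<open>n = card N\<close> and \<open>d\<close> the degree of
  the root, counting ordered pairs in two ways gives \<open>n M + d = 2 M + 2 A (n - 1)\<close>, that is,
  \<open>(n - 2) (M - 2 A) + (d - 2 A) = 0\<close>. Both \<open>M\<close> and \<open>d\<close> are at least \<open>2 A\<close>, and \<open>n \<ge> 3\<close>, so equality
  holds in both.\<close>

lemma uniform_type_cycle:
  assumes fin: "finite N" and r: "r \<notin> N" and full: "N \<subseteq> reach N" and C: "uniform_type N M A"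
    and inv: "parking_invariant N"
    and pq: "p \<in> N" "q \<in> N" "p \<noteq> q" "\<not> N - {p, q} \<subseteq> reach (N - {p, q})"
  shows "(\<forall>u\<in>insert r N. \<forall>v\<in>insert r N. w u v \<in> {0, A})" "M = 2 * A" "wt N r = 2 * A"
proof -
  have low: "wt (reach (N - {i} - {k})) k = A" if "i \<in> N" "k \<in> N - {i}" for i k
    using uniform_type_low_weight[OF C, of i k] that by auto
  have Apos: "A > 0" by (rule uniform_type_low_pos[OF fin r C pq(1-3)])
  have linked: "N - {i} \<subseteq> reach (N - {i})" if "i \<in> N" for i
    by (rule uniform_type_delete_reach[OF C that])
  have tree_p: "tree_type (N - {p}) A"
  proof -
    have ne: "N - {p} \<noteq> {}" using pq by auto
    have fin': "finite (N - {p})" "r \<notin> N - {p}" using fin r by auto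
    from fin' linked[OF pq(1)] uniform_type_invariant_delete[OF fin r C pq(1) inv] ne
    \<comment> \<open>Uniform type would make the graph without \<open>p\<close> and \<open>q\<close> connected.\<close>
    show ?thesis
    proof (cases rule: invariant_cases)
      case (tree M')
      have "M' = A" using tree(2) low[of p q] pq unfolding tree_type_def by auto
      then show ?thesis using tree by simp
    next
      case (uniform M' A')
      have "N - {p} - {q} \<subseteq> reach (N - {p} - {q})"
        using uniform_type_delete_reach[OF uniform(4)] pq by auto
      moreover have "N - {p} - {q} = N - {p, q}" by auto
      ultimately show ?thesis using pq by simp
    qed
  qed
  \<comment> \<open>The transposition of \<open>p\<close> and \<open>i\<close> transports the parking functions of \<open>G - p\<close> to those of \<open>G - i\<close>.\<close>
  have tree: "tree_type (N - {i}) A" if i: "i \<in> N" for i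
  proof -
    have fin': "finite (N - {k})" "r \<notin> N - {k}" for k using fin r by auto
    have "parking (N - {p}) (\<lambda>_. A - 1)"
      using tree_type_parking_iff[OF fin' linked[OF pq(1)] tree_p] Apos by simp
    then have "parking N ((\<lambda>_. A - 1)(p := M - 1))"
      using uniform_type_parking_delete[OF fin r C pq(1)] by simp
    then have "parking N (\<lambda>x. ((\<lambda>_. A - 1)(p := M - 1)) (transpose p i x))"
      by (rule invariant_transpose[OF inv pq(1) i])
    also have "(\<lambda>x. ((\<lambda>_. A - 1)(p := M - 1)) (transpose p i x)) = (\<lambda>_. A - 1)(i := M - 1)"
      by (auto simp: transpose_def)
    finally have pk: "parking (N - {i}) (\<lambda>_. A - 1)"
      using uniform_type_parking_delete[OF fin r C i] by blast
    have "A \<le> wt (reach (N - {i} - {k, l})) k \<or> A \<le> wt (reach (N - {i} - {k, l})) l"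
      if "k \<in> N - {i}" "l \<in> N - {i}" for k l
      using parking_reachD[OF fin'(2) pk, of "{k, l}"] that Apos by auto
    then show ?thesis using low[OF i] unfolding tree_type_def by blast
  qed
  have card3: "card N \<ge> 3"
  proof -
    obtain s where "s \<in> N - {p, q}" using pq(4) by auto
    then have "card {p, q, s} = 3" "{p, q, s} \<subseteq> N" using pq by auto
    then show ?thesis using fin by (metis card_mono)
  qed
  have avoid: "\<exists>i\<in>N. i \<noteq> u \<and> i \<noteq> v" for u v
  proof (rule ccontr)
    assume "\<not> ?thesis"
    then have "N \<subseteq> {u, v}" by auto
    then have "card N \<le> card {u, v}" by (intro card_mono) auto
    also have "\<dots> \<le> 2" by (simp add: card_insert_if)
    finally show False using card3 by simp
  qed
  show W: "\<forall>u\<in>insert r N. \<forall>v\<in>insert r N. w u v \<in> {0, A}"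
  proof (intro ballI)
    fix u v assume uv: "u \<in> insert r N" "v \<in> insert r N"
    obtain i where i: "i \<in> N" "i \<noteq> u" "i \<noteq> v" using avoid by blast
    show "w u v \<in> {0, A}"
      using tree_type_weights[OF _ _ linked[OF i(1)] tree[OF i(1)], of u v] uv i fin r by auto
  qed
  have mult: "A dvd wt X u" if "X \<subseteq> insert r N" "u \<in> insert r N" for X u
    unfolding wt_def
  proof (rule dvd_sum)
    fix v assume "v \<in> X"
    then have "v \<in> insert r N" using that(1) by blast
    then have "w u v \<in> {0, A}" by (rule bspec[OF bspec[OF W that(2)]])
    then show "A dvd w u v" by auto
  qed
  \<comment> \<open>\<open>M\<close> is a multiple of \<open>A\<close> that exceeds \<open>A\<close>.\<close>
  have M2: "2 * A \<le> M"
  proof -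
    have "wt (insert r (N - {p})) p = M" by (rule uniform_type_degree[OF C pq(1)])
    then have "A dvd M" using mult[of "insert r (N - {p})" p] pq by auto
    then obtain k where k: "M = A * k" by auto
    have "A < M" using C by (simp add: uniform_type_def)
    then have "k \<ge> 2" using k by (cases k rule: nat.exhaust) (auto simp: not_less_eq_eq Suc_le_eq)
    then show ?thesis using k by simp
  qed
  \<comment> \<open>The root has two neighbours: deleting one of them leaves the graph connected.\<close>
  have D2: "2 * A \<le> wt N r"
  proof -
    have pos: "wt (N - {i}) r > 0" if i: "i \<in> N" for i
    proof -
      have fi: "finite (N - {i})" "r \<notin> N - {i}" using fin r by auto
      have "parking (N - {i}) (\<lambda>_. 0)"
        using linked[OF i] reach_full_iff_parking_zero[OF fi] by simp
      moreover have "N - {i} \<noteq> {}" using avoid[of i i] by auto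
      ultimately obtain j where j: "j \<in> N - {i}" "0 < wt (insert r (N - {i} - (N - {i}))) j"
        unfolding parking_def by blast
      then have "w r j > 0" using sym[of r j] by (simp add: wt_def)
      then show ?thesis using wt_ge[OF fi(1) j(1), of r] by simp
    qed
    obtain j where j: "j \<in> N" "w r j > 0"
      using pos[OF pq(1)] by (metis wt_posE DiffD1)
    have "w r j = A" using W j by auto
    moreover have "A \<le> wt (N - {j}) r"
      using pos[OF j(1)] mult[of "N - {j}" r] by (auto intro: dvd_imp_le)
    moreover have "wt N r = w r j + wt (N - {j}) r"
      using wt_insert[of "N - {j}" j r] fin j by (simp add: insert_absorb)
    ultimately show ?thesis by simp
  qed
  have degV: "wt (insert r N) i = M" if "i \<in> N" for i
  proof -
    have "insert r N = insert i (insert r (N - {i}))" using that by auto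
    then have "wt (insert r N) i = w i i + wt (insert r (N - {i})) i"
      using fin r that wt_insert[of "insert r (N - {i})" i i] by auto
    then show ?thesis using uniform_type_degree[OF C that] loopless by simp
  qed
  have tot: "total_weight N = card N * M + wt N r"
    using fin r degV loopless by (simp add: total_weight_def wt_insert)
  have "total_weight N = 2 * M + total_weight (N - {p})"
  proof -
    let ?W = "insert r (N - {p})"
    have V: "insert r N = insert p ?W" "p \<notin> ?W" "finite ?W" using pq fin r by auto
    have "total_weight N = wt (insert p ?W) p + (\<Sum>u\<in>?W. wt (insert p ?W) u)"
      unfolding total_weight_def V(1) by (rule sum.insert[OF V(3,2)])
    also have "(\<Sum>u\<in>?W. wt (insert p ?W) u) = (\<Sum>u\<in>?W. w p u + wt ?W u)"
      using wt_insert[OF V(3,2)] sym[of p] by simp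
    also have "\<dots> = wt ?W p + total_weight (N - {p})"
      by (simp only: sum.distrib wt_def total_weight_def)
    also have "wt (insert p ?W) p = wt ?W p"
      using wt_insert[OF V(3,2)] loopless by simp
    finally show ?thesis using uniform_type_degree[OF C pq(1)] by simp
  qed
  also have "total_weight (N - {p}) = 2 * A * card (N - {p})"
    using fin r by (intro tree_type_total_weight linked pq tree) auto
  finally have eq: "card N * M + wt N r = 2 * M + 2 * A * card (N - {p})" using tot by simp
  \<comment> \<open>Writing the number of vertices as \<open>m + 3\<close> avoids subtraction on natural numbers.\<close>
  obtain m where m: "card N = m + 3" using card3 by (metis add.commute le_Suc_ex)
  have "card (N - {p}) = m + 2" using m pq fin by simp
  then have eq2: "(m + 1) * M + wt N r = (m + 1) * (2 * A) + 2 * A"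
    using eq m by (simp add: algebra_simps)
  have "(m + 1) * (2 * A) \<le> (m + 1) * M" using M2 by (intro mult_left_mono) auto
  then have e: "(m + 1) * M = (m + 1) * (2 * A)" "wt N r = 2 * A" using eq2 D2 by linarith+
  then show "M = 2 * A" "wt N r = 2 * A" by (simp_all only: mult_cancel1 add_is_0 one_neq_zero simp_thms)
qed

text \<open>For the converse direction, a vertex of \<open>U\<close> with an edge leaving \<open>U\<close> has at least \<open>A\<close> of them. This suffices unless it
  is the one vertex \<open>i\<close> with entry at least \<open>A\<close>. Then either \<open>U = {i}\<close>, and all \<open>2 A\<close> edges leave, or
  another vertex of \<open>U\<close> has an edge leaving \<open>U\<close>, because the graph without \<open>i\<close> is connected.\<close>

lemma uniform_type_cycle_parking_iff:
  assumes fin: "finite N" and r: "r \<notin> N" and full: "N \<subseteq> reach N" and C: "uniform_type N (2 * A) A"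
    and W: "\<forall>u\<in>insert r N. \<forall>v\<in>insert r N. w u v \<in> {0, A}"
  shows "parking N \<alpha> \<longleftrightarrow>
    (\<forall>i\<in>N. \<alpha> i < 2 * A) \<and> (\<forall>i\<in>N. \<forall>j\<in>N. i \<noteq> j \<longrightarrow> \<alpha> i < A \<or> \<alpha> j < A)"
proof (intro iffI conjI ballI impI)
  fix i assume pk: "parking N \<alpha>" and i: "i \<in> N"
  then show "\<alpha> i < 2 * A"
    using parking_reachD[OF r pk, of "{i}"] C by (auto simp: uniform_type_def)
next
  fix i j assume pk: "parking N \<alpha>" and ij: "i \<in> N" "j \<in> N" "i \<noteq> j"
  have "wt (reach (N - {i, j})) i = A" "wt (reach (N - {j, i})) j = A"
    using C ij by (simp_all add: uniform_type_def)
  moreover have "{j, i} = {i, j}" by auto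
  ultimately show "\<alpha> i < A \<or> \<alpha> j < A"
    using parking_reachD[OF r pk, of "{i, j}"] ij by auto
next
  assume le: "(\<forall>i\<in>N. \<alpha> i < 2 * A) \<and> (\<forall>i\<in>N. \<forall>j\<in>N. i \<noteq> j \<longrightarrow> \<alpha> i < A \<or> \<alpha> j < A)"
  show "parking N \<alpha>"
    unfolding parking_def
  proof (intro allI impI)
    fix U assume U: "U \<subseteq> N" "U \<noteq> {}"
    have large: "A \<le> wt (insert r (N - U)) j" if jU: "j \<in> U" and pos: "0 < wt (insert r (N - U)) j" for j
    proof -
      obtain k where k: "k \<in> insert r (N - U)" "w j k > 0" using wt_posE[OF pos] .
      have jk: "j \<in> insert r N" "k \<in> insert r N" using jU U k(1) by auto
      have "w j k \<in> {0, A}" by (rule bspec[OF bspec[OF W jk(1)] jk(2)])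
      then have "w j k = A" using k(2) by auto
      then show ?thesis using wt_ge[OF _ k(1), of j] fin by simp
    qed
    have "parking N (\<lambda>_. 0)" using full reach_full_iff_parking_zero[OF fin r] by simp
    then obtain i where i: "i \<in> U" "0 < wt (insert r (N - U)) i"
      using U unfolding parking_def by blast
    show "\<exists>i\<in>U. \<alpha> i < wt (insert r (N - U)) i"
    proof (cases "\<alpha> i < A")
      case True
      then show ?thesis using large[OF i] i(1) by (meson less_le_trans)
    next
      case big: False
      have iN: "i \<in> N" using i U by auto
      show ?thesis
      proof (cases "U = {i}")
        case True
        then show ?thesis using uniform_type_degree[OF C iN] le iN by auto
      next
        case False
        then have ne: "U - {i} \<subseteq> N - {i}" "U - {i} \<noteq> {}" using U i by auto
        have "parking (N - {i}) (\<lambda>_. 0)"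
          using uniform_type_delete_reach[OF C iN] reach_full_iff_parking_zero[of "N - {i}"]
            fin r by auto
        then obtain j where j: "j \<in> U - {i}" "0 < wt (insert r (N - {i} - (U - {i}))) j"
          using ne unfolding parking_def by blast
        have "N - {i} - (U - {i}) = N - U" using i by auto
        then have "A \<le> wt (insert r (N - U)) j" using large[of j] j by auto
        moreover have "\<alpha> j < A" using le big iN j U by blast
        ultimately show ?thesis using j by (meson DiffD1 less_le_trans)
      qed
    qed
  qed
qed

text \<open>The bound for \<open>U\<close> depends only on \<open>card U\<close>, so the hardest set \<open>U\<close> of each size consists of the positions
  of the largest entries.\<close>

lemma complete_parking_iff:
  assumes fin: "finite N" and r: "r \<notin> N"
    and wa: "\<And>p. p \<in> N \<Longrightarrow> w p r = a"
    and wb: "\<And>p q. p \<in> N \<Longrightarrow> q \<in> N \<Longrightarrow> p \<noteq> q \<Longrightarrow> w p q = b"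
  shows "parking N \<alpha> \<longleftrightarrow>
    (\<forall>j\<in>{1..card N}. j \<le> card {i\<in>N. \<alpha> i < a + (j - 1) * b})"
proof -
  have out: "wt (insert r (N - U)) i = a + (card N - card U) * b" if "U \<subseteq> N" "i \<in> U" for U i
  proof -
    have "wt (N - U) i = (\<Sum>j\<in>N - U. b)"
      unfolding wt_def using that wb by (intro sum.cong) auto
    then have "wt (N - U) i = (card N - card U) * b"
      using that fin by (simp add: card_Diff_subset finite_subset)
    then show ?thesis using wt_insert[of "N - U" r i] fin r wa that by auto
  qed
  show ?thesis
  proof
    assume pk: "parking N \<alpha>"
    show "\<forall>j\<in>{1..card N}. j \<le> card {i\<in>N. \<alpha> i < a + (j - 1) * b}"
    proof (rule ballI, rule ccontr)
      fix j assume j: "j \<in> {1..card N}" and "\<not> j \<le> card {i\<in>N. \<alpha> i < a + (j - 1) * b}"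
      then have less: "card {i\<in>N. \<alpha> i < a + (j - 1) * b} < j" by simp
      define U where "U = N - {i\<in>N. \<alpha> i < a + (j - 1) * b}"
      have "card U = card N - card {i\<in>N. \<alpha> i < a + (j - 1) * b}"
        unfolding U_def using fin by (intro card_Diff_subset) auto
      then have cU: "card N - card U \<le> j - 1" "card U > 0" using less j by auto
      have "U \<noteq> {}" using cU(2) by auto
      moreover have "U \<subseteq> N" by (auto simp: U_def)
      ultimately obtain i where i: "i \<in> U" "\<alpha> i < a + (card N - card U) * b"
        using pk out unfolding parking_def by metis
      have "(card N - card U) * b \<le> (j - 1) * b" using cU by (intro mult_right_mono) auto
      then have "\<alpha> i < a + (j - 1) * b" using i(2) by linarith
      then show False using i(1) by (simp add: U_def)
    qed
  next
    assume h: "\<forall>j\<in>{1..card N}. j \<le> card {i\<in>N. \<alpha> i < a + (j - 1) * b}"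
    show "parking N \<alpha>"
      unfolding parking_def
    proof (intro allI impI)
      fix U assume U: "U \<subseteq> N" "U \<noteq> {}"
      have cU: "card U \<le> card N" "card U > 0"
        using U fin by (auto simp: card_mono card_gt_0_iff intro: finite_subset)
      let ?B = "{i\<in>N. \<alpha> i < a + (card N - card U) * b}"
      have "Suc (card N - card U) \<in> {1..card N}" using cU by auto
      then have "Suc (card N - card U) \<le> card ?B" using h by fastforce
      then have gt: "card U + card ?B > card N" using cU by simp
      have "U \<inter> ?B \<noteq> {}"
      proof
        assume "U \<inter> ?B = {}"
        then have "card (U \<union> ?B) = card U + card ?B"
          using fin U by (intro card_Un_disjoint) (auto intro: finite_subset)
        moreover have "card (U \<union> ?B) \<le> card N" using fin U by (intro card_mono) auto
        ultimately show False using gt by simp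
      qed
      then show "\<exists>i\<in>U. \<alpha> i < wt (insert r (N - U)) i" using out[OF U(1)] by auto
    qed
  qed
qed

end

section \<open>Vector parking functions\<close>

lemma sorted_nth_less_iff:
  fixes xs :: "'a::linorder list"
  assumes "sorted xs" "k < length xs"
  shows "xs ! k < t \<longleftrightarrow> k < length (filter (\<lambda>x. x < t) xs)"
  using assms
proof (induction xs arbitrary: k)
  case (Cons x xs)
  show ?case
  proof (cases "x < t")
    case True
    then show ?thesis using Cons by (cases k) auto
  next
    case False
    then have all: "\<forall>y\<in>set (x # xs). \<not> y < t" using Cons.prems by auto
    then have "filter (\<lambda>x. x < t) (x # xs) = []" by (simp only: filter_empty_conv)
    moreover have "\<not> (x # xs) ! k < t" using all Cons.prems nth_mem by blast
    ultimately show ?thesis by simp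
  qed
qed simp

text \<open>This replaces sorting by counting, which makes the invariance of vector parking functions apparent.\<close>

lemma order_stat_less_iff:
  assumes "j \<in> {1..n}"
  shows "order_stat n \<alpha> j < t \<longleftrightarrow> j \<le> card {i\<in>{1..n}. \<alpha> i < t}"
proof -
  have "length (filter (\<lambda>x. x < t) (sort (map \<alpha> [1..<Suc n]))) =
      length (filter (\<lambda>i. \<alpha> i < t) [1..<Suc n])"
    by (simp add: filter_sort filter_map comp_def del: upt_Suc)
  also have "\<dots> = card ({i. \<alpha> i < t} \<inter> set [1..<Suc n])"
    by (rule distinct_length_filter) simp
  also have "{i. \<alpha> i < t} \<inter> set [1..<Suc n] = {i\<in>{1..n}. \<alpha> i < t}" by auto
  finally have "length (filter (\<lambda>x. x < t) (sort (map \<alpha> [1..<Suc n]))) =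
      card {i\<in>{1..n}. \<alpha> i < t}" .
  moreover have "order_stat n \<alpha> j < t \<longleftrightarrow>
      j - 1 < length (filter (\<lambda>x. x < t) (sort (map \<alpha> [1..<Suc n])))"
    unfolding order_stat_def using assms by (intro sorted_nth_less_iff) auto
  ultimately have "order_stat n \<alpha> j < t \<longleftrightarrow> j - 1 < card {i\<in>{1..n}. \<alpha> i < t}" by simp
  then show ?thesis using assms by auto
qed

lemma vector_PF_iff:
  "\<alpha> \<in> vector_PF n x \<longleftrightarrow> \<alpha> \<in> nat_vectors n \<and>
     (\<forall>j\<in>{1..n}. j \<le> card {i\<in>{1..n}. \<alpha> i < (\<Sum>k=1..j. x k)})"
proof -
  have "int (order_stat n \<alpha> j) \<le> int (\<Sum>k=1..j. x k) - 1 \<longleftrightarrow>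
      j \<le> card {i\<in>{1..n}. \<alpha> i < (\<Sum>k=1..j. x k)}" if "j \<in> {1..n}" for j
    unfolding order_stat_less_iff[OF that, symmetric] by linarith
  then show ?thesis unfolding vector_PF_def by auto
qed

lemma vector_PF_symmetric: "symmetric_invariant n (vector_PF n x)"
  unfolding symmetric_invariant_def
proof (intro allI impI ballI)
  fix \<sigma> \<alpha> assume s: "\<sigma> permutes {1..n}" and a: "\<alpha> \<in> vector_PF n x"
  have "card {i\<in>{1..n}. perm_act \<sigma> \<alpha> i < t} = card {i\<in>{1..n}. \<alpha> i < t}" for t
  proof -
    have "bij_betw \<sigma> {i\<in>{1..n}. \<alpha> i < t} {i\<in>{1..n}. perm_act \<sigma> \<alpha> i < t}"
    proof (rule bij_betw_byWitness[where f' = "inv \<sigma>"])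
      show "\<sigma> ` {i\<in>{1..n}. \<alpha> i < t} \<subseteq> {i\<in>{1..n}. perm_act \<sigma> \<alpha> i < t}"
        using permutes_in_image[OF s] permutes_inverses(2)[OF s] by (auto simp: perm_act_def)
      show "inv \<sigma> ` {i\<in>{1..n}. perm_act \<sigma> \<alpha> i < t} \<subseteq> {i\<in>{1..n}. \<alpha> i < t}"
        using permutes_in_image[OF permutes_inv[OF s]] by (auto simp: perm_act_def)
    qed (use permutes_inverses[OF s] in auto)
    then show ?thesis by (rule bij_betw_same_card[THEN HOL.sym])
  qed
  moreover have "perm_act \<sigma> \<alpha> \<in> nat_vectors n"
    using a permutes_not_in[OF permutes_inv[OF s]]
    by (auto simp: vector_PF_def nat_vectors_def perm_act_def PiE_iff extensional_def)
  ultimately show "perm_act \<sigma> \<alpha> \<in> vector_PF n x" using a by (simp add: vector_PF_iff)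
qed

lemma vector_PF_tree_iff:
  assumes "n \<ge> 1"
  shows "\<alpha> \<in> vector_PF n (\<lambda>i\<in>{1..n}. if i = 1 then a else 0) \<longleftrightarrow>
    \<alpha> \<in> nat_vectors n \<and> (\<forall>i\<in>{1..n}. \<alpha> i < a)"
proof -
  have "(\<Sum>k=1..j. (\<lambda>i\<in>{1..n}. if i = 1 then a else 0) k) = a" if "j \<in> {1..n}" for j
  proof -
    have "(\<Sum>k=1..j. (\<lambda>i\<in>{1..n}. if i = 1 then a else 0) k) = (\<Sum>k=1..j. if k = 1 then a else 0)"
      using that by (intro sum.cong) auto
    then show ?thesis using that by simp
  qed
  then have "\<alpha> \<in> vector_PF n (\<lambda>i\<in>{1..n}. if i = 1 then a else 0) \<longleftrightarrow>
      \<alpha> \<in> nat_vectors n \<and> (\<forall>j\<in>{1..n}. j \<le> card {i\<in>{1..n}. \<alpha> i < a})"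
    by (simp add: vector_PF_iff)
  moreover have "(\<forall>j\<in>{1..n}. j \<le> card {i\<in>{1..n}. \<alpha> i < a}) \<longleftrightarrow> n \<le> card {i\<in>{1..n}. \<alpha> i < a}"
    using assms by auto
  moreover have "n \<le> card {i\<in>{1..n}. \<alpha> i < a} \<longleftrightarrow> (\<forall>i\<in>{1..n}. \<alpha> i < a)"
  proof
    assume "n \<le> card {i\<in>{1..n}. \<alpha> i < a}"
    then have "{i\<in>{1..n}. \<alpha> i < a} = {1..n}" by (intro card_seteq) auto
    then show "\<forall>i\<in>{1..n}. \<alpha> i < a" by blast
  next
    assume "\<forall>i\<in>{1..n}. \<alpha> i < a"
    then have "{i\<in>{1..n}. \<alpha> i < a} = {1..n}" by blast
    then show "n \<le> card {i\<in>{1..n}. \<alpha> i < a}" by simp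
  qed
  ultimately show ?thesis by simp
qed

lemma card_filter_ge_iff:
  assumes "finite N"
  shows "card N - c \<le> card {i\<in>N. P i} \<longleftrightarrow> card {i\<in>N. \<not> P i} \<le> c"
proof -
  have "card N = card {i\<in>N. P i} + card {i\<in>N. \<not> P i}"
    using assms by (subst card_Un_disjoint[symmetric]) (auto intro: arg_cong[where f = card])
  then show ?thesis by linarith
qed

lemma vector_PF_cycle_iff:
  assumes "n \<ge> 2"
  shows "\<alpha> \<in> vector_PF n (\<lambda>i\<in>{1..n}. if i = 1 \<or> i = n then a else 0) \<longleftrightarrow>
    \<alpha> \<in> nat_vectors n \<and> (\<forall>i\<in>{1..n}. \<alpha> i < 2 * a) \<and>
    (\<forall>i\<in>{1..n}. \<forall>j\<in>{1..n}. i \<noteq> j \<longrightarrow> \<alpha> i < a \<or> \<alpha> j < a)"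
proof -
  let ?c = "\<lambda>t. card {i\<in>{1..n}. \<alpha> i < t}"
  have "(\<Sum>k=1..j. (\<lambda>i\<in>{1..n}. if i = 1 \<or> i = n then a else 0) k) = (if j = n then 2 * a else a)"
    if "j \<in> {1..n}" for j
  proof -
    have "(\<Sum>k=1..j. (\<lambda>i\<in>{1..n}. if i = 1 \<or> i = n then a else 0) k) =
        (\<Sum>k=1..j. (if k = 1 then a else 0) + (if k = n then a else 0))"
      using that assms by (intro sum.cong) auto
    then show ?thesis using that by (auto simp: sum.distrib)
  qed
  then have "\<alpha> \<in> vector_PF n (\<lambda>i\<in>{1..n}. if i = 1 \<or> i = n then a else 0) \<longleftrightarrow>
      \<alpha> \<in> nat_vectors n \<and> (\<forall>j\<in>{1..n}. j \<le> ?c (if j = n then 2 * a else a))"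
    by (simp add: vector_PF_iff)
  also have "(\<forall>j\<in>{1..n}. j \<le> ?c (if j = n then 2 * a else a)) \<longleftrightarrow> n - 0 \<le> ?c (2 * a) \<and> n - 1 \<le> ?c a"
  proof
    assume h: "\<forall>j\<in>{1..n}. j \<le> ?c (if j = n then 2 * a else a)"
    show "n - 0 \<le> ?c (2 * a) \<and> n - 1 \<le> ?c a"
    proof
      show "n - 0 \<le> ?c (2 * a)" using h[rule_format, of n] assms by simp
      have "n - 1 \<in> {1..n}" "n - 1 \<noteq> n" using assms by auto
      then show "n - 1 \<le> ?c a" using h[rule_format, of "n - 1"] by simp
    qed
  next
    assume h: "n - 0 \<le> ?c (2 * a) \<and> n - 1 \<le> ?c a"
    show "\<forall>j\<in>{1..n}. j \<le> ?c (if j = n then 2 * a else a)"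
    proof
      fix j assume "j \<in> {1..n}"
      then show "j \<le> ?c (if j = n then 2 * a else a)" using h by (cases "j = n") auto
    qed
  qed
  also have "n - 0 \<le> ?c (2 * a) \<longleftrightarrow> (\<forall>i\<in>{1..n}. \<alpha> i < 2 * a)"
  proof -
    have "n - 0 \<le> ?c (2 * a) \<longleftrightarrow> {i\<in>{1..n}. \<not> \<alpha> i < 2 * a} = {}"
      using card_filter_ge_iff[of "{1..n}" 0 "\<lambda>i. \<alpha> i < 2 * a"] by simp
    then show ?thesis by blast
  qed
  also have "n - 1 \<le> ?c a \<longleftrightarrow> (\<forall>i\<in>{1..n}. \<forall>j\<in>{1..n}. i \<noteq> j \<longrightarrow> \<alpha> i < a \<or> \<alpha> j < a)"
  proof -
    have "n - 1 \<le> ?c a \<longleftrightarrow> card {i\<in>{1..n}. \<not> \<alpha> i < a} \<le> Suc 0"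
      using card_filter_ge_iff[of "{1..n}" 1 "\<lambda>i. \<alpha> i < a"] by simp
    also have "\<dots> \<longleftrightarrow> (\<forall>i\<in>{i\<in>{1..n}. \<not> \<alpha> i < a}. \<forall>j\<in>{i\<in>{1..n}. \<not> \<alpha> i < a}. i = j)"
      by (rule card_le_Suc0_iff_eq) simp
    also have "\<dots> \<longleftrightarrow> (\<forall>i\<in>{1..n}. \<forall>j\<in>{1..n}. i \<noteq> j \<longrightarrow> \<alpha> i < a \<or> \<alpha> j < a)" by blast
    finally show ?thesis .
  qed
  finally show ?thesis .
qed

lemma vector_PF_complete_iff:
  "\<alpha> \<in> vector_PF n (\<lambda>i\<in>{1..n}. if i = 1 then a else b) \<longleftrightarrow>
    \<alpha> \<in> nat_vectors n \<and> (\<forall>j\<in>{1..n}. j \<le> card {i\<in>{1..n}. \<alpha> i < a + (j - 1) * b})"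
proof -
  have "(\<Sum>k=1..j. (\<lambda>i\<in>{1..n}. if i = 1 then a else b) k) = a + (j - 1) * b" if "j \<in> {1..n}" for j
  proof -
    have "(\<Sum>k=1..j. (\<lambda>i\<in>{1..n}. if i = 1 then a else b) k) = (\<Sum>k\<in>insert 1 {2..j}. if k = 1 then a else b)"
      using that by (intro sum.cong) auto
    also have "\<dots> = a + (\<Sum>k\<in>{2..j}. b)" by simp
    finally show ?thesis by simp
  qed
  then show ?thesis by (simp add: vector_PF_iff)
qed

section \<open>Multigraphs\<close>

text \<open>Each unordered pair corresponds to two ordered ones. This relates the number of edges of a multigraph
  to the sum of its degrees.\<close>

lemma sum_nsets_2:
  fixes g :: "'a set \<Rightarrow> nat"
  assumes "finite V"
  shows "2 * (\<Sum>e\<in>nsets V 2. g e) = (\<Sum>u\<in>V. \<Sum>v\<in>V - {u}. g {u, v})"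
  using assms
proof (induction V)
  case empty
  then show ?case by (simp add: nsets_def)
next
  case (insert x F)
  have eq: "nsets (insert x F) 2 = nsets F 2 \<union> (\<lambda>v. {x, v}) ` F"
    using insert(2) by (auto simp: nsets_2_eq insert_commute)
  have disj: "nsets F 2 \<inter> (\<lambda>v. {x, v}) ` F = {}"
    using insert(2) by (auto simp: nsets_def)
  have inj: "inj_on (\<lambda>v. {x, v}) F" by (auto simp: inj_on_def doubleton_eq_iff)
  have fin: "finite (nsets F 2)" using insert(1) by (rule finite_imp_finite_nsets)
  have "(\<Sum>e\<in>nsets (insert x F) 2. g e) = (\<Sum>e\<in>nsets F 2. g e) + (\<Sum>v\<in>F. g {x, v})"
    unfolding eq using fin insert(1) disj inj by (simp add: sum.union_disjoint sum.reindex)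
  moreover have "(\<Sum>v\<in>insert x F - {u}. g {u, v}) = g {x, u} + (\<Sum>v\<in>F - {u}. g {u, v})"
    if "u \<in> F" for u
  proof -
    have "insert x F - {u} = insert x (F - {u})" using that insert(2) by auto
    then show ?thesis using insert by (simp add: insert_commute)
  qed
  ultimately show ?case
    using insert by (simp add: sum.distrib)
qed

text \<open>The witness for being an \<open>a\<close>-tree or an \<open>a\<close>-cycle.\<close>

definition scaled_down :: "'v multigraph \<Rightarrow> nat \<Rightarrow> 'v multigraph" where
  "scaled_down G a =
     \<lparr>verts = verts G, root_vertex = root_vertex G, edge_weight = (\<lambda>e. edge_weight G e div a)\<rparr>"

definition multiplicity :: "'v multigraph \<Rightarrow> 'v \<Rightarrow> 'v \<Rightarrow> nat" where
  "multiplicity G u v = edge_weight G {u, v}"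

locale multigraph_upto =
  fixes G :: "nat multigraph" and n :: nat
  assumes n: "n \<ge> 1" and mg: "multigraph G" and verts: "verts G = {0..n}" and root_0: "root_vertex G = 0"
begin

sublocale rooted_weights "multiplicity G" 0
proof
  fix u v :: nat
  show "multiplicity G u v = multiplicity G v u" by (simp add: multiplicity_def insert_commute)
  have "{u, u} \<notin> nsets (verts G) 2" by (simp add: nsets_def)
  then show "multiplicity G u u = 0" using mg unfolding multigraph_def multiplicity_def by blast
qed

lemma nonroots: "nonroots G = {1..n}"
proof -
  have "{0..n} - {0} = {1..n}" by auto
  then show ?thesis unfolding nonroots_def verts root_0 .
qed

lemma degree_out_eq:
  assumes "U \<subseteq> {1..n}"
  shows "degree_out G U i = wt (insert 0 ({1..n} - U)) i"
proof -
  have "verts G - U = insert 0 ({1..n} - U)" unfolding verts using assms by auto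
  then show ?thesis by (simp add: degree_out_def wt_def multiplicity_def)
qed

lemma graph_PF_iff: "\<alpha> \<in> graph_PF G \<longleftrightarrow> \<alpha> \<in> nat_vectors n \<and> parking {1..n} \<alpha>"
proof -
  have "int a \<le> int b - 1 \<longleftrightarrow> a < b" for a b :: nat by linarith
  then show ?thesis
    using degree_out_eq by (auto simp: graph_PF_def nonroots nat_vectors_def parking_def)
qed

lemma connected_iff: "connected_multigraph G \<longleftrightarrow> {1..n} \<subseteq> reach {1..n}"
proof -
  have "{1..n} \<subseteq> reach {1..n} \<longleftrightarrow> parking {1..n} (\<lambda>_. 0)"
    by (rule reach_full_iff_parking_zero) auto
  then show ?thesis
    by (simp add: parking_def connected_multigraph_def nonroots Suc_le_eq degree_out_eq
        imp_conjL)
qed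

lemma symmetric_invariant_imp_parking_invariant:
  assumes "symmetric_invariant n (graph_PF G)"
  shows "parking_invariant {1..n}"
  unfolding parking_invariant_def
proof (intro allI impI)
  fix \<sigma> \<alpha> assume s: "\<sigma> permutes {1..n}" and pk: "parking {1..n} \<alpha>"
  have "restrict \<alpha> {1..n} \<in> graph_PF G"
    using pk parking_cong[of "{1..n}" \<alpha> "restrict \<alpha> {1..n}"] by (simp add: graph_PF_iff nat_vectors_def)
  then have "perm_act (inv \<sigma>) (restrict \<alpha> {1..n}) \<in> graph_PF G"
    using assms permutes_inv[OF s] unfolding symmetric_invariant_def by blast
  then have "parking {1..n} (perm_act (inv \<sigma>) (restrict \<alpha> {1..n}))" by (simp add: graph_PF_iff)
  then show "parking {1..n} (\<lambda>x. \<alpha> (\<sigma> x))"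
    using permutes_in_image[OF s]
    by (subst parking_cong[of _ _ "perm_act (inv \<sigma>) (restrict \<alpha> {1..n})"])
      (auto simp: perm_act_def permutes_inv_inv[OF s])
qed

lemma insert_0: "insert 0 {1..n} = {0..n}"
  by auto

lemma scaled_down_multigraph:
  assumes a: "a > 0" and W: "\<forall>u\<in>{0..n}. \<forall>v\<in>{0..n}. multiplicity G u v \<in> {0, a}"
    and conn: "connected_multigraph G"
  defines "H \<equiv> scaled_down G a"
  shows "\<And>e. edge_weight G e = a * edge_weight H e" "multigraph H" "connected_multigraph H"
proof -
  have outside: "edge_weight G e = 0" if "e \<notin> nsets {0..n} 2" for e
    using mg verts that unfolding multigraph_def by auto
  show eq: "edge_weight G e = a * edge_weight H e" for e
  proof (cases "e \<in> nsets {0..n} 2")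
    case True
    then obtain u v where e: "e = {u, v}" "u \<in> {0..n}" "v \<in> {0..n}"
      unfolding nsets_2_eq by blast
    then have "edge_weight G e \<in> {0, a}" using W unfolding multiplicity_def by metis
    then show ?thesis using a by (auto simp: H_def scaled_down_def)
  qed (simp add: outside H_def scaled_down_def)
  show "multigraph H"
    using mg by (auto simp: multigraph_def H_def scaled_down_def)
  have "verts H = verts G" by (simp add: H_def scaled_down_def)
  then have out: "degree_out G U i = a * degree_out H U i" for U i
    by (simp add: degree_out_def sum_distrib_left eq)
  have "degree_out H U i \<ge> 1" if "degree_out G U i \<ge> 1" for U i
    by (rule ccontr) (use that out[of U i] in simp)
  moreover have "nonroots H = nonroots G" by (simp add: nonroots_def H_def scaled_down_def)
  ultimately show "connected_multigraph H"
    using conn unfolding connected_multigraph_def by metis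
qed

lemma tree_type_imp_a_tree:
  assumes conn: "connected_multigraph G" and M: "M > 0" and T: "tree_type {1..n} M"
  shows "is_a_tree M G \<and> graph_PF G = vector_PF n (\<lambda>i\<in>{1..n}. if i = 1 then M else 0)"
proof
  have full: "{1..n} \<subseteq> reach {1..n}" using conn connected_iff by simp
  have N: "finite {1..n}" "0 \<notin> {1..n}" by auto
  have W: "\<forall>u\<in>{0..n}. \<forall>v\<in>{0..n}. multiplicity G u v \<in> {0, M}"
    using tree_type_weights[OF N full T] unfolding insert_0 by blast
  define H where "H = scaled_down G M"
  note H = scaled_down_multigraph[OF M W conn, folded H_def]
  have vH: "verts H = {0..n}" using verts by (simp add: H_def scaled_down_def)
  have "2 * num_edges H * M = (\<Sum>u\<in>{0..n}. \<Sum>v\<in>{0..n} - {u}. edge_weight H {u, v}) * M"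
    using sum_nsets_2[of "{0..n}" "edge_weight H"] by (simp add: num_edges_def vH)
  also have "\<dots> = (\<Sum>u\<in>{0..n}. \<Sum>v\<in>{0..n} - {u}. multiplicity G u v)"
    by (simp add: H(1) multiplicity_def sum_distrib_left mult.commute)
  also have "\<dots> = total_weight {1..n}"
    unfolding total_weight_def wt_def insert_0
  proof (rule sum.cong[OF refl])
    fix u assume "u \<in> {0..n}"
    then show "(\<Sum>v\<in>{0..n} - {u}. multiplicity G u v) = (\<Sum>v\<in>{0..n}. multiplicity G u v)"
      using sum.remove[of "{0..n}" u "\<lambda>v. multiplicity G u v"] loopless[of u] by simp
  qed
  also have "\<dots> = 2 * n * M"
    using tree_type_total_weight[OF N full T] by simp
  finally have "num_edges H = n" using M by simp
  then have "is_tree H" using H vH by (simp add: is_tree_def)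
  then show "is_a_tree M G" unfolding is_a_tree_def using H(1) vH verts by metis
  show "graph_PF G = vector_PF n (\<lambda>i\<in>{1..n}. if i = 1 then M else 0)"
    by (rule set_eqI) (simp only: vector_PF_tree_iff[OF n] graph_PF_iff
        tree_type_parking_iff[OF N full T])
qed

lemma uniform_type_imp_a_cycle:
  assumes conn: "connected_multigraph G" and C: "uniform_type {1..n} (2 * A) A" and A: "A > 0"
    and n2: "n \<ge> 2"
    and W: "\<forall>u\<in>{0..n}. \<forall>v\<in>{0..n}. multiplicity G u v \<in> {0, A}"
    and deg0: "wt {1..n} 0 = 2 * A"
  shows "is_a_cycle A G \<and> graph_PF G = vector_PF n (\<lambda>i\<in>{1..n}. if i = 1 \<or> i = n then A else 0)"
proof
  have full: "{1..n} \<subseteq> reach {1..n}" using conn connected_iff by simp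
  have N: "finite {1..n}" "0 \<notin> {1..n}" by auto
  define H where "H = scaled_down G A"
  note H = scaled_down_multigraph[OF A W conn, folded H_def]
  have vH: "verts H = {0..n}" using verts by (simp add: H_def scaled_down_def)
  have "degree H i = 2" if i: "i \<in> {0..n}" for i
  proof -
    have "degree G i = wt ({0..n} - {i}) i" by (simp add: degree_def wt_def verts multiplicity_def)
    also have "\<dots> = 2 * A"
    proof (cases "i = 0")
      case True
      have "{0..n} - {0} = {1..n}" by auto
      then show ?thesis using True deg0 by simp
    next
      case False
      then have "{0..n} - {i} = insert 0 ({1..n} - {i})" "i \<in> {1..n}" using i by auto
      then show ?thesis using uniform_type_degree[OF C] by simp
    qed
    finally have "A * degree H i = A * 2"
      by (simp add: degree_def H(1) sum_distrib_left vH verts)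
    then show ?thesis using A by simp
  qed
  then have "is_cycle H" using H vH by (simp add: is_cycle_def)
  then show "is_a_cycle A G" unfolding is_a_cycle_def using H(1) vH verts by metis
  show "graph_PF G = vector_PF n (\<lambda>i\<in>{1..n}. if i = 1 \<or> i = n then A else 0)"
    by (rule set_eqI) (simp only: vector_PF_cycle_iff[OF n2] graph_PF_iff
        uniform_type_cycle_parking_iff[OF N full C W[folded insert_0]])
qed

lemma constant_weights_imp_complete:
  assumes a: "\<And>p. p \<in> {1..n} \<Longrightarrow> multiplicity G p 0 = a"
    and b: "\<And>p q. p \<in> {1..n} \<Longrightarrow> q \<in> {1..n} \<Longrightarrow> p \<noteq> q \<Longrightarrow> multiplicity G p q = b"
  shows "G = complete_multigraph n a b \<and>
    graph_PF G = vector_PF n (\<lambda>i\<in>{1..n}. if i = 1 then a else b)"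
proof
  have "edge_weight G e = edge_weight (complete_multigraph n a b) e" for e
  proof (cases "e \<in> nsets {0..n} 2")
    case False
    then show ?thesis using mg verts by (auto simp: multigraph_def complete_multigraph_def)
  next
    case True
    then obtain u v where e: "e = {u, v}" "u \<in> {0..n}" "v \<in> {0..n}" "u \<noteq> v"
      unfolding nsets_2_eq by blast
    have "edge_weight G e = (if 0 \<in> e then a else b)"
    proof (cases "u = 0 \<or> v = 0")
      case T: True
      then show ?thesis using a[of u] a[of v] e by (auto simp: multiplicity_def insert_commute)
    next
      case F: False
      then show ?thesis using b[of u v] e by (auto simp: multiplicity_def)
    qed
    then show ?thesis using True by (simp add: complete_multigraph_def)
  qed
  then show "G = complete_multigraph n a b"
    using verts root_0 by (intro multigraph.equality) (auto simp: complete_multigraph_def)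
  have N: "finite {1..n}" "0 \<notin> {1..n}" by auto
  have card: "card {1..n} = n" by simp
  have park: "parking {1..n} \<alpha> \<longleftrightarrow>
      (\<forall>j\<in>{1..card {1..n}}. j \<le> card {i\<in>{1..n}. \<alpha> i < a + (j - 1) * b})" for \<alpha>
    by (rule complete_parking_iff[OF N]) (fact a b)+
  show "graph_PF G = vector_PF n (\<lambda>i\<in>{1..n}. if i = 1 then a else b)"
    by (rule set_eqI) (simp only: vector_PF_complete_iff graph_PF_iff park card)
qed

lemma classification:
  assumes conn: "connected_multigraph G" and inv: "symmetric_invariant n (graph_PF G)"
  obtains (tree) a where "a \<ge> 1" "is_a_tree a G"
      "graph_PF G = vector_PF n (\<lambda>i\<in>{1..n}. if i = 1 then a else 0)"
  | (cycle) a where "a \<ge> 1" "is_a_cycle a G" "n \<ge> 2"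
      "graph_PF G = vector_PF n (\<lambda>i\<in>{1..n}. if i = 1 \<or> i = n then a else 0)"
  | (complete) a b where "a \<ge> 1" "b \<ge> 1" "G = complete_multigraph n a b"
      "graph_PF G = vector_PF n (\<lambda>i\<in>{1..n}. if i = 1 then a else b)"
proof -
  have full: "{1..n} \<subseteq> reach {1..n}" using conn connected_iff by simp
  have N: "finite {1..n}" "0 \<notin> {1..n}" by auto
  have pinv: "parking_invariant {1..n}" by (rule symmetric_invariant_imp_parking_invariant[OF inv])
  have ne: "{1..n} \<noteq> {}" using n by simp
  from N full pinv ne show thesis
  proof (cases rule: invariant_cases)
    case (tree M)
    then show ?thesis using tree_type_imp_a_tree[OF conn tree] that(1)[of M] by simp
  next
    case (uniform M A p q)
    have n2: "n \<ge> 2" using uniform(1-3) by auto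
    show ?thesis
    proof (cases "\<forall>p\<in>{1..n}. \<forall>q\<in>{1..n}. p \<noteq> q \<longrightarrow> {1..n} - {p, q} \<subseteq> reach ({1..n} - {p, q})")
      case True
      show ?thesis
      proof (rule uniform_type_complete[OF N full uniform(4) ne])
        fix p q assume "p \<in> {1..n}" "q \<in> {1..n}" "p \<noteq> q"
        then show "{1..n} - {p, q} \<subseteq> reach ({1..n} - {p, q})" by (rule True[rule_format])
      next
        fix a b :: nat
        assume ab: "a > 0" "b > 0" "\<And>p. p \<in> {1..n} \<Longrightarrow> multiplicity G p 0 = a"
          "\<And>p q. p \<in> {1..n} \<Longrightarrow> q \<in> {1..n} \<Longrightarrow> p \<noteq> q \<Longrightarrow> multiplicity G p q = b"
        have "G = complete_multigraph n a b \<and>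
            graph_PF G = vector_PF n (\<lambda>i\<in>{1..n}. if i = 1 then a else b)"
          by (rule constant_weights_imp_complete) (fact ab)+
        then show ?thesis using ab(1,2) by (intro that(3)[of a b]) auto
      qed
    next
      case False
      then obtain s t where st: "s \<in> {1..n}" "t \<in> {1..n}" "s \<noteq> t"
        "\<not> {1..n} - {s, t} \<subseteq> reach ({1..n} - {s, t})" by metis
      note cyc = uniform_type_cycle[OF N full uniform(4) pinv st, unfolded insert_0]
      have "A > 0" by (rule uniform_type_low_pos[OF N uniform(4) uniform(1-3)])
      moreover have "uniform_type {1..n} (2 * A) A" using uniform(4) unfolding cyc(2) .
      ultimately have "is_a_cycle A G \<and>
          graph_PF G = vector_PF n (\<lambda>i\<in>{1..n}. if i = 1 \<or> i = n then A else 0)"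
        by (intro uniform_type_imp_a_cycle[OF conn _ _ n2 cyc(1) cyc(3)])
      then show ?thesis using \<open>A > 0\<close> n2 by (intro that(2)[of A]) auto
    qed
  qed
qed

end

section \<open>Comparison of graphical and vector parking functions\<close>

theorem theorem2p5:
  fixes n :: nat and G :: "nat multigraph"
  assumes "n \<ge> 1"
    and "multigraph G" and "verts G = {0..n}" and "root_vertex G = 0"
  shows
    "(connected_multigraph G \<and> symmetric_invariant n (graph_PF G) \<longrightarrow>
        (\<exists>a\<ge>1. is_a_tree a G \<and>
           graph_PF G = vector_PF n (\<lambda>i\<in>{1..n}. if i = 1 then a else 0)) \<or>
        (\<exists>a\<ge>1. is_a_cycle a G \<and> n \<ge> 2 \<and>
           graph_PF G = vector_PF n (\<lambda>i\<in>{1..n}. if i = 1 \<or> i = n then a else 0)) \<or>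
        (\<exists>a\<ge>1. \<exists>b\<ge>1. G = complete_multigraph n a b \<and>
           graph_PF G = vector_PF n (\<lambda>i\<in>{1..n}. if i = 1 then a else b)))
     \<and> (\<not> symmetric_invariant n (graph_PF G) \<longrightarrow>
        (\<forall>x\<in>nat_vectors n. graph_PF G \<noteq> vector_PF n x))"
proof -
  interpret multigraph_upto G n by unfold_locales (use assms in auto)
  show ?thesis
  proof (intro conjI impI ballI notI)
    assume "connected_multigraph G \<and> symmetric_invariant n (graph_PF G)"
    then have "connected_multigraph G" "symmetric_invariant n (graph_PF G)" by auto
    then show "(\<exists>a\<ge>1. is_a_tree a G \<and>
           graph_PF G = vector_PF n (\<lambda>i\<in>{1..n}. if i = 1 then a else 0)) \<or>
        (\<exists>a\<ge>1. is_a_cycle a G \<and> n \<ge> 2 \<and>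
           graph_PF G = vector_PF n (\<lambda>i\<in>{1..n}. if i = 1 \<or> i = n then a else 0)) \<or>
        (\<exists>a\<ge>1. \<exists>b\<ge>1. G = complete_multigraph n a b \<and>
           graph_PF G = vector_PF n (\<lambda>i\<in>{1..n}. if i = 1 then a else b))"
      by (cases rule: classification) blast+
  next
    fix x assume "\<not> symmetric_invariant n (graph_PF G)" "graph_PF G = vector_PF n x"
    then show False using vector_PF_symmetric[of n x] by simp
  qed
qed

end
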